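(* Under Assumptions 1 and 3, for every $T\ge1$ there exists a policy $\Pi\in\Pi^C_W$ with $J_{\pi_0}(\Pi,T)=\inf_{\Pi'\in\Pi^C_W}J_{\pi_0}(\Pi',T)$, and with $J^T_T\equiv0$ and $$J^T_t(\pi)=\min_{Q\in\mathcal Q_c}\Big(\tfrac1T c(\pi,Q)+E\big[J^T_{t+1}(\pi_{t+1})\mid\pi_t=\pi,Q_t=Q\big]\Big)$$ for $t=T-1,\dots,1$, $\pi\in\mathcal S$, and for $t=0$, $\pi=\pi_0$, one has $J^T_0(\pi_0)=\min_{\Pi\in\Pi^C_W}J_{\pi_0}(\Pi,T)$.
   Context: Assumption 1: the source is $x_{t+1}=f(x_t,w_t)$ with $f:\mathbb R^d\times\mathbb R^d\to\mathbb R^d$ Borel, $\{w_t\}$ i.i.d. and independent of $x_0\sim\pi_0$; for each $x$ the law of $f(x,w_0)$ has a density $\phi(\cdot|x)$ which is strictly positive everywhere, bounded by $C$ and $C_1$-Lipschitz, uniformly in $x$. Assumption 3: (i) $\|f(x,w)\|\le K(\|x\|+\|w\|)$ for some $K>0$; (ii) $\mathbb U=\mathbb R^d$ and $c_0(x,u)=\|x-u\|^2$; (iii) $\int\|z\|^2\nu_w(dz)<\infty$ where $\nu_w$ is the law of $w_t$; (iv) $\pi_0$ has a density with finite second moment or is a point mass. $\mathcal S$: probability measures on $\mathbb R^d$ with density bounded by $C$ and $C_1$-Lipschitz. $\mathcal Q_c$: Borel maps $Q:\mathbb R^d\to\{1,\dots,M\}$ with all cells $Q^{-1}(i)$ convex.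 $\Pi^C_W$: policies given by Borel maps $\hat\eta_t:\mathcal P(\mathbb R^d)\to\mathcal Q_c$; $Q_t=\hat\eta_t(\pi_t)$, $q_t=Q_t(x_t)$, with $\pi_t(\cdot)=P(x_t\in\cdot\mid q_{[0,t-1]})$. Beliefs evolve by $\pi_{t+1}=\hat\pi(q_t,\pi_t,Q_t)$, $P(q_t=m\mid\pi_t,Q_t)=\pi_t(Q_t^{-1}(m))$, where $\hat\pi(m,\pi,Q)$ has density $z\mapsto\pi(Q^{-1}(m))^{-1}\int_{Q^{-1}(m)}\phi(z|x)\pi(dx)$. Cost $c(\pi,Q)=\sum_i\inf_{u\in\mathbb R^d}\int_{Q^{-1}(i)}\|x-u\|^2\pi(dx)$ and $J_{\pi_0}(\Pi,T)=E^\Pi_{\pi_0}[\frac1T\sum_{t=0}^{T-1}c(\pi_t,Q_t)]$. *)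

theory Defs
  imports "HOL-Probability.Probability"
begin

text \<open>Conventions: the state space R^d is an arbitrary euclidean_space type 'a.
  A quantizer is a map Q :: 'a => nat with values in {1..M}; its i-th cell is Q -` {i}.
  phi z x is the transition density phi(z|x).  Costs are ennreal-valued.\<close>

definition Qc :: "nat \<Rightarrow> ('a::euclidean_space \<Rightarrow> nat) set" where
  "Qc M = {Q. Q \<in> measurable borel (count_space UNIV)
              \<and> (\<forall>x. Q x \<in> {1..M})
              \<and> (\<forall>i\<in>{1..M}. convex (Q -` {i}))}"

definition qcost :: "nat \<Rightarrow> 'a::euclidean_space measure \<Rightarrow> ('a \<Rightarrow> nat) \<Rightarrow> ennreal" where
  "qcost M \<pi> Q = (\<Sum>i\<in>{1..M}. INF u. \<integral>\<^sup>+ x. ennreal ((norm (x - u))\<^sup>2) * indicator (Q -` {i}) x \<partial>\<pi>)"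

definition belief_update ::
  "('a::euclidean_space \<Rightarrow> 'a \<Rightarrow> real) \<Rightarrow> nat \<Rightarrow> 'a measure \<Rightarrow> ('a \<Rightarrow> nat) \<Rightarrow> 'a measure" where
  "belief_update phi m \<pi> Q =
     density lborel (\<lambda>z. (\<integral>\<^sup>+ x. ennreal (phi z x) * indicator (Q -` {m}) x \<partial>\<pi>) / emeasure \<pi> (Q -` {m}))"

definition S_class :: "real \<Rightarrow> real \<Rightarrow> 'a::euclidean_space measure set" where
  "S_class C C1 = {\<pi>. prob_space \<pi> \<and> (\<exists>g. \<pi> = density lborel (\<lambda>x. ennreal (g x))
                        \<and> (\<forall>x. 0 \<le> g x \<and> g x \<le> C) \<and> lipschitz_on C1 UNIV g)}"

text \<open>Policies Pi^C_W: for each t a Borel map from P(R^d) (Giry sigma-algebra) to Q_c,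
  measurability understood jointly in (pi, x).\<close>
definition policies :: "nat \<Rightarrow> (nat \<Rightarrow> 'a::euclidean_space measure \<Rightarrow> 'a \<Rightarrow> nat) set" where
  "policies M = {\<eta>. \<forall>t. (\<forall>\<pi>\<in>space (prob_algebra borel). \<eta> t \<pi> \<in> Qc M)
       \<and> (\<lambda>(\<pi>, x). \<eta> t \<pi> x) \<in> measurable (prob_algebra borel \<Otimes>\<^sub>M borel) (count_space UNIV)}"

text \<open>One-stage value: (1/T) c(pi,Q) + E[V(pi_{t+1}) | pi_t = pi, Q_t = Q].\<close>
definition stage_val ::
  "('a::euclidean_space \<Rightarrow> 'a \<Rightarrow> real) \<Rightarrow> nat \<Rightarrow> nat \<Rightarrow> ('a measure \<Rightarrow> ennreal)
     \<Rightarrow> 'a measure \<Rightarrow> ('a \<Rightarrow> nat) \<Rightarrow> ennreal" where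
  "stage_val phi M T V \<pi> Q =
     qcost M \<pi> Q / of_nat T + (\<Sum>m\<in>{1..M}. emeasure \<pi> (Q -` {m}) * V (belief_update phi m \<pi> Q))"

fun cost_to_go ::
  "('a::euclidean_space \<Rightarrow> 'a \<Rightarrow> real) \<Rightarrow> nat \<Rightarrow> nat \<Rightarrow> (nat \<Rightarrow> 'a measure \<Rightarrow> 'a \<Rightarrow> nat)
     \<Rightarrow> nat \<Rightarrow> nat \<Rightarrow> 'a measure \<Rightarrow> ennreal" where
  "cost_to_go phi M T \<eta> 0 t \<pi> = 0"
| "cost_to_go phi M T \<eta> (Suc n) t \<pi> =
     stage_val phi M T (cost_to_go phi M T \<eta> n (Suc t)) \<pi> (\<eta> t \<pi>)"

text \<open>J_{pi0}(Pi,T) = E[(1/T) sum_{t<T} c(pi_t,Q_t)].\<close>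
definition Jcost ::
  "('a::euclidean_space \<Rightarrow> 'a \<Rightarrow> real) \<Rightarrow> nat \<Rightarrow> 'a measure \<Rightarrow> (nat \<Rightarrow> 'a measure \<Rightarrow> 'a \<Rightarrow> nat)
     \<Rightarrow> nat \<Rightarrow> ennreal" where
  "Jcost phi M \<pi>0 \<eta> T = cost_to_go phi M T \<eta> T 0 \<pi>0"

fun dpV :: "('a::euclidean_space \<Rightarrow> 'a \<Rightarrow> real) \<Rightarrow> nat \<Rightarrow> nat \<Rightarrow> nat \<Rightarrow> 'a measure \<Rightarrow> ennreal" where
  "dpV phi M T 0 \<pi> = 0"
| "dpV phi M T (Suc n) \<pi> = (INF Q\<in>Qc M. stage_val phi M T (dpV phi M T n) \<pi> Q)"

definition dpJ :: "('a::euclidean_space \<Rightarrow> 'a \<Rightarrow> real) \<Rightarrow> nat \<Rightarrow> nat \<Rightarrow> nat \<Rightarrow> 'a measure \<Rightarrow> ennreal" where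
  "dpJ phi M T t \<pi> = dpV phi M T (T - t) \<pi>"

end

theory Submission
  imports Defs
begin

text \<open>
  The value functions are lower semicontinuous along almost everywhere convergence of densities,
  by backward induction. The disjoint convex cells of quantizers are pairwise separated by
  hyperplanes, and a finite family of normalized hyperplanes subconverges, so every sequence of
  quantizers has a subsequence that converges almost everywhere to a quantizer in \<open>Qc M\<close>.
  Along it, Fatou's lemma bounds the distortion and the induction hypothesis bounds the
  continuation cost; cells whose mass vanishes in the limit only help. Hence minimizers exist at
  every belief with a density, whereas for a point mass the stage value does not depend on the
  quantizer. From a fixed initial belief only finitely many beliefs are reachable, so the
  minimizers can be assembled into a measurable policy without a selection theorem.
\<close>

section \<open>Compactness of convex-cell quantizers\<close>

text \<open>Only lower semicontinuity can be expected: second moments may escape to infinity along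
  a.e. convergent densities, so the distortion need not converge. The mode of convergence is chosen
  so that the belief update reproduces it: if densities and labels converge a.e., posterior
  densities of cells with positive limit mass converge at every point, because \<open>phi\<close> is
  bounded and all densities have total mass one. A point mass breaks this, as a.e. convergence of
  quantizers says nothing at its atom; it can occur only as the initial belief, since every
  posterior of a cell of positive mass has a density. Hyperplanes are normalized jointly in normal
  and offset, so that one drifting to infinity still has a limit, namely a nonzero constant
  function.\<close>

lemma common_convergent_subseq:
  fixes X :: "'i \<Rightarrow> nat \<Rightarrow> 'b::topological_space"
  assumes "finite I"
    and conv: "\<And>i s. i \<in> I \<Longrightarrow> strict_mono (s::nat \<Rightarrow> nat) \<Longrightarrow>
      \<exists>r l. strict_mono r \<and> (\<lambda>k. X i (s (r k))) \<longlonglongrightarrow> l"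
  shows "\<exists>r l. strict_mono (r::nat \<Rightarrow> nat) \<and> (\<forall>i\<in>I. (\<lambda>k. X i (r k)) \<longlonglongrightarrow> l i)"
  using assms
proof (induction I rule: finite_induct)
  case empty
  show ?case by (auto intro!: exI[of _ id] simp: strict_mono_id)
next
  case (insert j I)
  have "\<exists>r l. strict_mono (r::nat \<Rightarrow> nat) \<and> (\<forall>i\<in>I. (\<lambda>k. X i (r k)) \<longlonglongrightarrow> l i)"
    by (rule insert.IH, rule insert.prems, rule insertI2)
  then obtain s l where s: "strict_mono (s::nat \<Rightarrow> nat)" and l: "\<forall>i\<in>I. (\<lambda>k. X i (s k)) \<longlonglongrightarrow> l i"
    by blast
  \<comment> \<open>Convergence is assumed along every subsequence \<open>s\<close>, so the new
    index can be treated inside the subsequence already found for the others.\<close>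
  obtain r l' where r: "strict_mono r" and l': "(\<lambda>k. X j (s (r k))) \<longlonglongrightarrow> l'"
    using insert.prems[OF insertI1 s] by blast
  have "(\<lambda>k. X i (s (r k))) \<longlonglongrightarrow> l i" if "i \<in> I" for i
    using LIMSEQ_subseq_LIMSEQ[OF l[rule_format, OF that] r] by (simp add: o_def)
  then have "\<forall>i\<in>insert j I. (\<lambda>k. X i (s (r k))) \<longlonglongrightarrow> (l(j := l')) i"
    using l' insert.hyps(2) by auto
  moreover have "strict_mono (\<lambda>k. s (r k))"
    using strict_mono_o[OF s r] by (simp add: o_def)
  ultimately show ?case by blast
qed

text \<open>The affine function b - a . x is coded by the vector (-a, b) of the product space,
  acting through the inner product with (x, 1). Unit length puts all these vectors on one compact
  sphere; if a set is empty, the constant functions -1 and 1 do.\<close>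

lemma normalized_separating_hyperplane:
  fixes S T :: "'a::euclidean_space set"
  assumes "convex S" "convex T" "S \<inter> T = {}"
  shows "\<exists>h::'a \<times> real. norm h = 1 \<and> (\<forall>x\<in>S. 0 \<le> h \<bullet> (x, 1)) \<and> (\<forall>x\<in>T. h \<bullet> (x, 1) \<le> 0)"
proof -
  consider "S = {}" | "T = {}" | "S \<noteq> {}" "T \<noteq> {}" by blast
  then show ?thesis
  proof cases
    case 1
    then show ?thesis by (intro exI[of _ "(0, -1)"]) (auto simp: norm_Pair)
  next
    case 2
    then show ?thesis by (intro exI[of _ "(0, 1)"]) (auto simp: norm_Pair)
  next
    case 3
    obtain a b where ab: "a \<noteq> 0" "\<forall>x\<in>S. a \<bullet> x \<le> b" "\<forall>x\<in>T. b \<le> a \<bullet> x"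
      using separating_hyperplane_sets[OF assms(1,2) 3 assms(3)] by blast
    define h where "h = (- a, b)"
    have "h \<noteq> 0" using ab(1) by (auto simp: h_def zero_prod_def)
    moreover have "0 \<le> (h /\<^sub>R norm h) \<bullet> (x, 1)" if "x \<in> S" for x
      using ab(2) that by (auto simp: h_def simp del: scaleR_Pair simp: inner_scaleR_left)
    moreover have "(h /\<^sub>R norm h) \<bullet> (x, 1) \<le> 0" if "x \<in> T" for x
      using ab(3) that by (auto simp: h_def simp del: scaleR_Pair simp: inner_scaleR_left mult_nonneg_nonpos)
    ultimately show ?thesis by (intro exI[of _ "h /\<^sub>R norm h"]) auto
  qed
qed

lemma ex_direction_avoiding_hyperplanes:
  fixes A :: "'a::euclidean_space set"
  assumes "finite A" "0 \<notin> A"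
  shows "\<exists>v. \<forall>a\<in>A. a \<bullet> v \<noteq> 0"
proof -
  have "negligible (\<Union>a\<in>A. {v. a \<bullet> v = 0})"
    using assms by (intro negligible_Union) (auto intro!: negligible_hyperplane)
  then have "(\<Union>a\<in>A. {v. a \<bullet> v = 0}) \<noteq> UNIV"
    using non_negligible_UNIV by metis
  then show ?thesis by auto
qed

text \<open>The sign is that of \<open>c\<close>, or that of \<open>d\<close> if \<open>c\<close> is
  zero: the sign at a point moved infinitesimally, which breaks ties on a hyperplane.\<close>

lemma eventually_sgn_const:
  fixes c d :: real
  assumes "c \<noteq> 0 \<or> d \<noteq> 0"
  shows "\<exists>s. s \<noteq> 0 \<and> (\<forall>\<^sub>F n in sequentially. sgn (c + d / real (Suc n)) = s)"
proof (cases "c = 0")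
  case True
  then show ?thesis using assms by (intro exI[of _ "sgn d"]) (auto simp: sgn_divide sgn_zero_iff)
next
  case False
  have "(\<lambda>n. c + d / real (Suc n)) \<longlonglongrightarrow> c + 0"
    by (intro tendsto_intros LIMSEQ_Suc[OF lim_const_over_n])
  then have "(\<lambda>n. sgn (c + d / real (Suc n))) \<longlonglongrightarrow> sgn c"
    using False by (intro tendsto_sgn) auto
  then have "\<forall>\<^sub>F n in sequentially. dist (sgn (c + d / real (Suc n))) (sgn c) < 1"
    by (rule tendstoD) simp
  then have "\<forall>\<^sub>F n in sequentially. sgn (c + d / real (Suc n)) = sgn c"
    by eventually_elim (auto simp: dist_real_def sgn_if split: if_splits)
  then show ?thesis using False by (intro exI[of _ "sgn c"]) (auto simp: sgn_zero_iff)
qed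

text \<open>The limiting half-spaces determine the label off finitely many hyperplanes; on these, ties
  are broken by an infinitesimal shift in a direction \<open>v\<close> transversal to all of them, which keeps
  the cells convex and Borel.\<close>

lemma Qc_sequentially_compact:
  fixes Qs :: "nat \<Rightarrow> 'a::euclidean_space \<Rightarrow> nat"
  assumes Qs: "\<And>k. Qs k \<in> Qc M"
  shows "\<exists>r Q. strict_mono (r::nat \<Rightarrow> nat) \<and> Q \<in> Qc M \<and>
    (AE x in lborel. \<forall>\<^sub>F k in sequentially. Qs (r k) x = Q x)"
proof -
  have range: "Qs k x \<in> {1..M}" for k x
    using Qs by (auto simp: Qc_def)
  define P where "P = {(i, j). i \<in> {1..M} \<and> j \<in> {1..M} \<and> i \<noteq> j}"
  have finP: "finite P"
    by (rule finite_subset[of _ "{1..M} \<times> {1..M}"]) (auto simp: P_def)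
  have "\<exists>h::'a \<times> real. norm h = 1 \<and> (\<forall>x. Qs k x = fst p \<longrightarrow> 0 \<le> h \<bullet> (x, 1)) \<and>
      (\<forall>x. Qs k x = snd p \<longrightarrow> h \<bullet> (x, 1) \<le> 0)" if "p \<in> P" for p k
  proof -
    have "convex (Qs k -` {fst p})" "convex (Qs k -` {snd p})"
      "Qs k -` {fst p} \<inter> Qs k -` {snd p} = {}"
      using that Qs[of k] by (auto simp: P_def Qc_def)
    from normalized_separating_hyperplane[OF this] show ?thesis
      by (simp only: vimage_singleton_eq Ball_def)
  qed
  then obtain H :: "nat \<times> nat \<Rightarrow> nat \<Rightarrow> 'a \<times> real" where
    H1: "\<And>p k. p \<in> P \<Longrightarrow> norm (H p k) = 1" and
    Hpos: "\<And>p k x. p \<in> P \<Longrightarrow> Qs k x = fst p \<Longrightarrow> 0 \<le> H p k \<bullet> (x, 1)" and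
    Hneg: "\<And>p k x. p \<in> P \<Longrightarrow> Qs k x = snd p \<Longrightarrow> H p k \<bullet> (x, 1) \<le> 0"
    by metis
  have "\<exists>r l. strict_mono r \<and> (\<lambda>k. H p (s (r k))) \<longlonglongrightarrow> l"
    if "p \<in> P" "strict_mono (s::nat \<Rightarrow> nat)" for p s
  proof -
    have "bounded (range (\<lambda>k. H p (s k)))"
      using H1[OF that(1)] by (auto simp: bounded_iff)
    from bounded_imp_convergent_subsequence[OF this] show ?thesis
      by (metis (no_types, lifting) comp_apply ext)
  qed
  from common_convergent_subseq[where X = H, OF finP this]
  obtain r h where r: "strict_mono (r::nat \<Rightarrow> nat)"
    and h: "\<And>p. p \<in> P \<Longrightarrow> (\<lambda>k. H p (r k)) \<longlonglongrightarrow> h p"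
    by blast
  have h1: "norm (h p) = 1" if "p \<in> P" for p
    using tendsto_norm[OF h[OF that]] H1[OF that] by (simp add: LIMSEQ_const_iff)
  have h_at: "(\<lambda>k. H p (r k) \<bullet> (x, 1)) \<longlonglongrightarrow> h p \<bullet> (x, 1)" if "p \<in> P" for p x
    by (intro tendsto_intros h that)
  \<comment> \<open>\<open>W i\<close> is where the limit functions let label \<open>i\<close> beat
    every other label strictly; \<open>N\<close> collects the limit hyperplanes, on which some
    comparison is undecided.\<close>
  define W where "W i = {y. \<forall>j\<in>{1..M} - {i}. 0 < h (i, j) \<bullet> (y, 1)}" for i
  define N where "N = (\<Union>p\<in>P. {y. h p \<bullet> (y, 1) = 0})"
  have h_inner: "h p \<bullet> (y, 1) = fst (h p) \<bullet> y + snd (h p)" for p y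
    by (cases "h p") simp
  have h0: "fst (h p) \<noteq> 0 \<or> snd (h p) \<noteq> 0" if "p \<in> P" for p
    using h1[OF that] by (metis norm_zero zero_neq_one prod.collapse zero_prod_def)
  \<comment> \<open>A strict inequality at the limit holds for all large k, and then any other label
    j would force the (i, j) separating function to be nonpositive.\<close>
  have W_limit: "\<forall>\<^sub>F k in sequentially. Qs (r k) y = i" if "i \<in> {1..M}" "y \<in> W i" for i y
  proof -
    have "\<forall>\<^sub>F k in sequentially. \<forall>j\<in>{1..M} - {i}. 0 < H (i, j) (r k) \<bullet> (y, 1)"
      using that
      by (intro eventually_ball_finite ballI order_tendstoD(1)[OF h_at]) (auto simp: P_def W_def)
    then show ?thesis
    proof eventually_elim
      case (elim k)
      show "Qs (r k) y = i"
      proof (rule ccontr)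
        assume "Qs (r k) y \<noteq> i"
        then have "(i, Qs (r k) y) \<in> P" "Qs (r k) y \<in> {1..M} - {i}"
          using that range by (auto simp: P_def)
        then show False using elim Hneg[of "(i, Qs (r k) y)" "r k" y] by (metis not_le snd_conv)
      qed
    qed
  qed
  have winner: "\<exists>i\<in>{1..M}. y \<in> W i" if "y \<notin> N" for y
  proof -
    \<comment> \<open>For one large k all strictly negative limit signs are already visible in
      \<open>H p (r k)\<close>; the label that \<open>Qs (r k)\<close> gives to \<open>y\<close>
      then has nonnegative, and off \<open>N\<close> positive, limit comparisons.\<close>
    have "\<forall>\<^sub>F k in sequentially. \<forall>p\<in>P. h p \<bullet> (y, 1) < 0 \<longrightarrow> H p (r k) \<bullet> (y, 1) < 0"
      using finP by (intro eventually_ball_finite ballI)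
        (auto intro: order_tendstoD(2)[OF h_at] elim: eventually_mono)
    then obtain k where k: "\<forall>p\<in>P. h p \<bullet> (y, 1) < 0 \<longrightarrow> H p (r k) \<bullet> (y, 1) < 0"
      using eventually_happens'[OF sequentially_bot] by blast
    have "0 < h (Qs (r k) y, j) \<bullet> (y, 1)" if "j \<in> {1..M} - {Qs (r k) y}" for j
    proof -
      have "(Qs (r k) y, j) \<in> P" using that range by (auto simp: P_def)
      moreover from this have "h (Qs (r k) y, j) \<bullet> (y, 1) \<noteq> 0" using \<open>y \<notin> N\<close> by (auto simp: N_def)
      ultimately show ?thesis using k Hpos[of "(Qs (r k) y, j)" "r k" y]
        by (metis fst_conv linorder_neqE_linordered_idom not_le)
    qed
    then show ?thesis using range by (intro bexI[of _ "Qs (r k) y"]) (auto simp: W_def)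
  qed
  obtain v where v: "\<And>p. p \<in> P \<Longrightarrow> fst (h p) \<noteq> 0 \<Longrightarrow> fst (h p) \<bullet> v \<noteq> 0"
    using ex_direction_avoiding_hyperplanes[of "(\<lambda>p. fst (h p)) ` P - {0}"] finP by auto
  define sh where "sh n x = x + v /\<^sub>R real (Suc n)" for n x
  define L where "L i = {x. \<forall>\<^sub>F n in sequentially. sh n x \<in> W i}" for i
  have ex1: "\<exists>!i. i \<in> {1..M} \<and> x \<in> L i" for x
  proof -
    have "\<exists>s. s \<noteq> 0 \<and> (\<forall>\<^sub>F n in sequentially. sgn (h p \<bullet> (sh n x, 1)) = s)" if "p \<in> P" for p
    proof -
      \<comment> \<open>Either \<open>v\<close> crosses the hyperplane transversally, or the normal
        vanishes and the limit function is a nonzero constant.\<close>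
      have "h p \<bullet> (x, 1) \<noteq> 0 \<or> fst (h p) \<bullet> v \<noteq> 0"
        using v[OF that] h0[OF that] by (cases "fst (h p) = 0") (auto simp: h_inner)
      from eventually_sgn_const[OF this] show ?thesis
        by (simp add: h_inner sh_def inner_add_right algebra_simps divide_inverse)
    qed
    then obtain s where s0: "\<And>p. p \<in> P \<Longrightarrow> s p \<noteq> 0"
      and s: "\<And>p. p \<in> P \<Longrightarrow> \<forall>\<^sub>F n in sequentially. sgn (h p \<bullet> (sh n x, 1)) = s p"
      by metis
    have "\<forall>\<^sub>F n in sequentially. \<forall>p\<in>P. sgn (h p \<bullet> (sh n x, 1)) = s p"
      using finP s by (intro eventually_ball_finite) auto
    then obtain n0 where n0: "\<And>n p. n \<ge> n0 \<Longrightarrow> p \<in> P \<Longrightarrow> sgn (h p \<bullet> (sh n x, 1)) = s p"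
      by (auto simp: eventually_sequentially)
    have "sh n0 x \<notin> N"
      using n0[of n0] s0 by (force simp: N_def)
    then obtain i where i: "i \<in> {1..M}" "sh n0 x \<in> W i" using winner by blast
    have "sh n x \<in> W i" if "n \<ge> n0" for n
      unfolding W_def
    proof (intro CollectI ballI)
      fix j assume "j \<in> {1..M} - {i}"
      then have "(i, j) \<in> P" "0 < h (i, j) \<bullet> (sh n0 x, 1)" using i by (auto simp: P_def W_def)
      then have "sgn (h (i, j) \<bullet> (sh n x, 1)) = 1"
        using n0[OF that, of "(i, j)"] n0[of n0 "(i, j)"] by simp
      then show "0 < h (i, j) \<bullet> (sh n x, 1)" by (simp add: sgn_1_pos)
    qed
    then have "x \<in> L i" by (auto simp: L_def eventually_sequentially)
    \<comment> \<open>Two winning regions cannot share a point: there \<open>Qs (r k)\<close> would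
      have both labels for large k.\<close>
    moreover have "i' = i''" if "i' \<in> {1..M}" "i'' \<in> {1..M}" "x \<in> L i'" "x \<in> L i''" for i' i''
    proof -
      have "\<forall>\<^sub>F n in sequentially. sh n x \<in> W i' \<and> sh n x \<in> W i''"
        using that by (auto simp: L_def eventually_conj_iff)
      then obtain n where "sh n x \<in> W i'" "sh n x \<in> W i''"
        using eventually_happens'[OF sequentially_bot] by blast
      then have "\<forall>\<^sub>F k in sequentially. Qs (r k) (sh n x) = i' \<and> Qs (r k) (sh n x) = i''"
        using W_limit that by (intro eventually_conj) auto
      then show ?thesis
        using eventually_happens'[OF sequentially_bot] by blast
    qed
    ultimately show ?thesis using i(1) by blast
  qed
  define Q where "Q x = (THE i. i \<in> {1..M} \<and> x \<in> L i)" for x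
  have Q: "Q x \<in> {1..M}" "x \<in> L (Q x)" for x
    using theI'[OF ex1[of x]] by (auto simp: Q_def)
  have QL: "Q x = i \<longleftrightarrow> x \<in> L i" if "i \<in> {1..M}" for x i
    using Q[of x] ex1[of x] that by blast
  have openW: "open (W i)" for i
    unfolding W_def by (simp add: Collect_ball_eq)
      (intro open_INT ballI open_Collect_less continuous_intros; simp)
  have convW: "u *\<^sub>R a + w *\<^sub>R b \<in> W i"
    if "a \<in> W i" "b \<in> W i" "0 \<le> u" "0 \<le> w" "u + w = 1" for a b u w i
    unfolding W_def
  proof (intro CollectI ballI)
    fix j assume j: "j \<in> {1..M} - {i}"
    have "h (i, j) \<bullet> (u *\<^sub>R a + w *\<^sub>R b, 1) = h (i, j) \<bullet> (u *\<^sub>R (a, 1) + w *\<^sub>R (b, 1))"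
      using that by simp
    also have "\<dots> = u * (h (i, j) \<bullet> (a, 1)) + w * (h (i, j) \<bullet> (b, 1))"
      by (simp only: inner_add_right inner_scaleR_right)
    also have "\<dots> > 0"
    proof -
      have "0 < h (i, j) \<bullet> (a, 1)" "0 < h (i, j) \<bullet> (b, 1)"
        using that j by (auto simp: W_def)
      then show ?thesis using that
        by (cases "u = 0") (auto intro: add_pos_nonneg)
    qed
    finally show "0 < h (i, j) \<bullet> (u *\<^sub>R a + w *\<^sub>R b, 1)" .
  qed
  have "convex (L i)" for i
  proof (rule convexI)
    fix a b and u w :: real
    assume *: "a \<in> L i" "b \<in> L i" "0 \<le> u" "0 \<le> w" "u + w = 1"
    \<comment> \<open>The shift commutes with convex combinations because the weights sum to
      one.\<close>
    have eq: "sh n (u *\<^sub>R a + w *\<^sub>R b) = u *\<^sub>R sh n a + w *\<^sub>R sh n b" for n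
    proof -
      have "u *\<^sub>R (a + e) + w *\<^sub>R (b + e) = u *\<^sub>R a + w *\<^sub>R b + (u + w) *\<^sub>R e" for e
        by (simp only: scaleR_add_left scaleR_add_right add_ac)
      then show ?thesis using * by (simp add: sh_def)
    qed
    have "\<forall>\<^sub>F n in sequentially. sh n a \<in> W i \<and> sh n b \<in> W i"
      using * by (auto simp: L_def eventually_conj_iff)
    then show "u *\<^sub>R a + w *\<^sub>R b \<in> L i"
      unfolding L_def mem_Collect_eq eq
      by eventually_elim (auto intro!: convW *)
  qed
  moreover have "L i \<in> sets borel" for i
  proof -
    have [measurable]: "W i \<in> sets borel" using openW by auto
    have [measurable]: "sh n \<in> borel \<rightarrow>\<^sub>M borel" for n
      unfolding sh_def by measurable
    have "Measurable.pred borel (\<lambda>x. \<exists>m. \<forall>n\<ge>m. sh n x \<in> W i)" by measurable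
    then show ?thesis by (simp add: L_def eventually_sequentially pred_def)
  qed
  moreover have "Q -` {i} = (if i \<in> {1..M} then L i else {})" for i
    using Q(1) QL by auto
  ultimately have "Q \<in> Qc M"
    using Q(1) unfolding Qc_def
    by (auto simp: measurable_count_space_eq2_countable)
  moreover have "AE x in lborel. \<forall>\<^sub>F k in sequentially. Qs (r k) x = Q x"
  proof -
    have "negligible N"
      unfolding N_def
    proof (intro negligible_Union; clarsimp simp: finP)
      fix i j assume "(i, j) \<in> P"
      \<comment> \<open>A zero normal leaves a nonzero offset and hence an empty set, so both cases
        are negligible.\<close>
      then have "fst (h (i, j)) \<noteq> 0 \<or> - snd (h (i, j)) \<noteq> 0"
        using h0[of "(i, j)"] by simp
      moreover have "{y. h (i, j) \<bullet> (y, 1) = 0} = {y. fst (h (i, j)) \<bullet> y = - snd (h (i, j))}"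
        unfolding h_inner by (simp only: eq_neg_iff_add_eq_0)
      ultimately show "negligible {y. h (i, j) \<bullet> (y, 1) = 0}"
        using negligible_hyperplane by metis
    qed
    then have "AE x in lborel. x \<notin> N"
      by (metis AE_completion_iff AE_not_in negligible_iff_null_sets)
    then show ?thesis
    proof eventually_elim
      case (elim x)
      then obtain i where i: "i \<in> {1..M}" "x \<in> W i" using winner by blast
      \<comment> \<open>Off \<open>N\<close> the point lies in an open region, which absorbs the
        vanishing shift: tie breaking changes nothing there.\<close>
      have "(\<lambda>n. sh n x) \<longlonglongrightarrow> x + 0 *\<^sub>R v"
        unfolding sh_def by (intro tendsto_intros LIMSEQ_inverse_real_of_nat)
      then have "\<forall>\<^sub>F n in sequentially. sh n x \<in> W i"
        using openW i(2) by (intro topological_tendstoD) auto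
      then have "Q x = i" using QL[OF i(1)] by (simp add: L_def)
      then show ?case using W_limit[OF i] by simp
    qed
  qed
  ultimately show ?thesis using r by blast
qed

section \<open>Convergence of beliefs and distortions\<close>

definition prob_density :: "('a::euclidean_space \<Rightarrow> ennreal) \<Rightarrow> bool" where
  "prob_density g \<longleftrightarrow> g \<in> borel_measurable borel \<and> (\<integral>\<^sup>+ x. g x \<partial>lborel) = 1"

lemma prob_density_measurable [measurable_dest]: "prob_density g \<Longrightarrow> g \<in> borel_measurable borel"
  by (simp add: prob_density_def)

lemma prob_density_AE_finite: "prob_density g \<Longrightarrow> AE x in lborel. g x \<noteq> \<infinity>"
  by (rule nn_integral_PInf_AE) (auto simp: prob_density_def)

lemma prob_density_iff_prob_space:
  assumes "g \<in> borel_measurable borel"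
  shows "prob_density g \<longleftrightarrow> prob_space (density lborel g)"
proof -
  have "emeasure (density lborel g) (space (density lborel g)) = (\<integral>\<^sup>+ x. g x \<partial>lborel)"
    using assms by (simp add: emeasure_density)
  then show ?thesis
    using assms by (auto simp: prob_density_def intro: prob_spaceI dest: prob_space.emeasure_space_1)
qed

lemma Fatou_weighted:
  fixes g :: "'a::euclidean_space \<Rightarrow> ennreal"
  assumes g: "prob_density g" and gs [measurable]: "\<And>k. gs k \<in> borel_measurable borel"
    and as [measurable]: "\<And>k. as k \<in> borel_measurable borel"
    and lim: "AE x in lborel. (\<lambda>k. gs k x) \<longlonglongrightarrow> g x" "AE x in lborel. (\<lambda>k. as k x) \<longlonglongrightarrow> a x"
  shows "(\<integral>\<^sup>+ x. a x * g x \<partial>lborel) \<le> liminf (\<lambda>k. \<integral>\<^sup>+ x. as k x * gs k x \<partial>lborel)"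
proof -
  have "AE x in lborel. a x * g x \<le> liminf (\<lambda>k. as k x * gs k x)"
    using lim prob_density_AE_finite[OF g]
  proof eventually_elim
    case (elim x)
    show ?case
    proof (cases "a x = 0 \<or> g x = 0")
      case False
      then have "(\<lambda>k. as k x * gs k x) \<longlonglongrightarrow> a x * g x"
        using elim by (intro tendsto_mult_ennreal) auto
      then show ?thesis by (simp add: lim_imp_Liminf)
    qed auto
  qed
  then have "(\<integral>\<^sup>+ x. a x * g x \<partial>lborel) \<le> (\<integral>\<^sup>+ x. liminf (\<lambda>k. as k x * gs k x) \<partial>lborel)"
    by (rule nn_integral_mono_AE)
  also have "\<dots> \<le> liminf (\<lambda>k. \<integral>\<^sup>+ x. as k x * gs k x \<partial>lborel)"
    by (rule nn_integral_liminf) simp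
  finally show ?thesis .
qed

text \<open>With X + Y constant, a lower bound on the limit inferior of Y is an upper bound on the
  limit superior of X, so two one-sided estimates give convergence.\<close>

lemma tendsto_of_complementary_liminf:
  fixes X Y :: "nat \<Rightarrow> real"
  assumes sum: "\<And>k. X k + Y k = x + y" and pos: "\<And>k. 0 \<le> X k" "\<And>k. 0 \<le> Y k" "0 \<le> x" "0 \<le> y"
    and X: "ennreal x \<le> liminf (\<lambda>k. ennreal (X k))" and Y: "ennreal y \<le> liminf (\<lambda>k. ennreal (Y k))"
  shows "X \<longlonglongrightarrow> x"
proof (rule tendstoI)
  fix e :: real assume e: "0 < e"
  have *: "\<forall>\<^sub>F k in sequentially. z - e < Z k"
    if "ennreal z \<le> liminf (\<lambda>k. ennreal (Z k))" "\<And>k. 0 \<le> Z k" "0 \<le> z" for z Z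
  proof (cases "z - e < 0")
    case True
    then show ?thesis using that(2) by (intro always_eventually) (smt (verit))
  next
    case False
    then have "ennreal (z - e) < liminf (\<lambda>k. ennreal (Z k))"
      using e that by (intro less_le_trans[OF _ that(1)]) (auto intro!: ennreal_lessI)
    then have "\<forall>\<^sub>F k in sequentially. ennreal (z - e) < ennreal (Z k)"
      by (rule less_LiminfD)
    then show ?thesis
      using False by (auto elim!: eventually_mono simp: ennreal_less_iff)
  qed
  have "\<forall>\<^sub>F k in sequentially. x - e < X k" "\<forall>\<^sub>F k in sequentially. y - e < Y k"
    using X Y pos by (auto intro!: *)
  then show "\<forall>\<^sub>F k in sequentially. dist (X k) x < e"
  proof eventually_elim
    case (elim k)
    then show ?case using sum[of k] by (auto simp: dist_real_def abs_less_iff)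
  qed
qed

text \<open>Fatou's lemma is applied both to the weights and to their complements to \<open>C\<close>.\<close>

lemma weighted_integral_tendsto:
  fixes g :: "'a::euclidean_space \<Rightarrow> ennreal" and a :: "'a \<Rightarrow> real"
  assumes g: "prob_density g" and gs: "\<And>k. prob_density (gs k)"
    and as [measurable]: "\<And>k. as k \<in> borel_measurable borel" and a [measurable]: "a \<in> borel_measurable borel"
    and bnd: "\<And>k x. 0 \<le> as k x \<and> as k x \<le> C" "\<And>x. 0 \<le> a x \<and> a x \<le> C"
    and lim: "AE x in lborel. (\<lambda>k. gs k x) \<longlonglongrightarrow> g x" "AE x in lborel. (\<lambda>k. as k x) \<longlonglongrightarrow> a x"
  shows "(\<lambda>k. \<integral>\<^sup>+ x. ennreal (as k x) * gs k x \<partial>lborel) \<longlonglongrightarrow> (\<integral>\<^sup>+ x. ennreal (a x) * g x \<partial>lborel)"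
proof -
  note [measurable] = prob_density_measurable[OF g] prob_density_measurable[OF gs]
  define F where "F b p = (\<integral>\<^sup>+ x. ennreal (b x) * p x \<partial>lborel)" for b :: "'a \<Rightarrow> real" and p
  have C0: "0 \<le> C" using bnd(2) by (meson order_trans)
  \<comment> \<open>Total mass one makes the integrals of \<open>b\<close> and \<open>C - b\<close>
    complementary, and in particular bounds both by \<open>C\<close>.\<close>
  have split: "F b p + F (\<lambda>x. C - b x) p = ennreal C"
    if "prob_density p" "b \<in> borel_measurable borel" "\<And>x. 0 \<le> b x \<and> b x \<le> C" for b p
  proof -
    note [measurable] = prob_density_measurable[OF that(1)] that(2)
    have "F b p + F (\<lambda>x. C - b x) p = (\<integral>\<^sup>+ x. ennreal (b x) * p x + ennreal (C - b x) * p x \<partial>lborel)"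
      unfolding F_def by (subst nn_integral_add) auto
    also have "\<dots> = (\<integral>\<^sup>+ x. ennreal C * p x \<partial>lborel)"
      using that(3) by (intro nn_integral_cong)
        (simp add: distrib_right[symmetric] ennreal_plus[symmetric] del: ennreal_plus)
    also have "\<dots> = ennreal C"
      using that(1) by (subst nn_integral_cmult) (auto simp: prob_density_def)
    finally show ?thesis .
  qed
  have fin: "F b p = ennreal (enn2real (F b p))" "F (\<lambda>x. C - b x) p = ennreal (enn2real (F (\<lambda>x. C - b x) p))"
    if "prob_density p" "b \<in> borel_measurable borel" "\<And>x. 0 \<le> b x \<and> b x \<le> C" for b p
  proof -
    have "F b p + F (\<lambda>x. C - b x) p < \<infinity>"
      unfolding split[OF that] by simp
    then show "F b p = ennreal (enn2real (F b p))" "F (\<lambda>x. C - b x) p = ennreal (enn2real (F (\<lambda>x. C - b x) p))"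
      by (auto simp: ennreal_enn2real_if)
  qed
  have rsplit: "enn2real (F b p) + enn2real (F (\<lambda>x. C - b x) p) = C"
    if "prob_density p" "b \<in> borel_measurable borel" "\<And>x. 0 \<le> b x \<and> b x \<le> C" for b p
  proof -
    have "ennreal (enn2real (F b p) + enn2real (F (\<lambda>x. C - b x) p)) = ennreal C"
      using split[OF that] fin[OF that] by (simp add: ennreal_plus)
    then show ?thesis using C0 by (subst (asm) ennreal_inj) auto
  qed
  have lim1: "AE x in lborel. (\<lambda>k. ennreal (as k x)) \<longlonglongrightarrow> ennreal (a x)"
    using lim(2) by eventually_elim auto
  have lim2: "AE x in lborel. (\<lambda>k. ennreal (C - as k x)) \<longlonglongrightarrow> ennreal (C - a x)"
    using lim(2) by eventually_elim (auto intro!: tendsto_intros)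
  have "(\<lambda>k. enn2real (F (as k) (gs k))) \<longlonglongrightarrow> enn2real (F a g)"
  proof (rule tendsto_of_complementary_liminf[where Y = "\<lambda>k. enn2real (F (\<lambda>x. C - as k x) (gs k))"
        and y = "enn2real (F (\<lambda>x. C - a x) g)"])
    show "ennreal (enn2real (F a g)) \<le> liminf (\<lambda>k. ennreal (enn2real (F (as k) (gs k))))"
      using Fatou_weighted[OF g _ _ lim(1) lim1]
      by (simp add: fin(1)[OF g a bnd(2), symmetric] fin(1)[OF gs as bnd(1), symmetric]) (simp add: F_def)
    show "ennreal (enn2real (F (\<lambda>x. C - a x) g)) \<le> liminf (\<lambda>k. ennreal (enn2real (F (\<lambda>x. C - as k x) (gs k))))"
      using Fatou_weighted[OF g _ _ lim(1) lim2]
      by (simp add: fin(2)[OF g a bnd(2), symmetric] fin(2)[OF gs as bnd(1), symmetric]) (simp add: F_def)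
  qed (auto simp: rsplit[OF g a bnd(2)] rsplit[OF gs as bnd(1)])
  then have "(\<lambda>k. ennreal (enn2real (F (as k) (gs k)))) \<longlonglongrightarrow> ennreal (enn2real (F a g))"
    by auto
  then show ?thesis
    by (simp add: fin(1)[OF g a bnd(2), symmetric] fin(1)[OF gs as bnd(1), symmetric]) (simp add: F_def)
qed

text \<open>As in Scheffe's theorem, the common total mass one is what makes a.e. convergence of
  densities control integrals. Labels are discrete, so their convergence is eventual
  equality.\<close>

definition conv_pair where
  "conv_pair gs Qs g Q \<longleftrightarrow>
     (\<forall>k. prob_density (gs k)) \<and> prob_density (g :: 'a::euclidean_space \<Rightarrow> ennreal) \<and>
     (\<forall>k. Qs k \<in> borel \<rightarrow>\<^sub>M count_space UNIV) \<and> Q \<in> borel \<rightarrow>\<^sub>M count_space (UNIV::nat set) \<and>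
     (AE x in lborel. (\<lambda>k. gs k x) \<longlonglongrightarrow> g x) \<and>
     (AE x in lborel. \<forall>\<^sub>F k in sequentially. Qs k x = Q x)"

lemma conv_pair_subseq:
  assumes "conv_pair gs Qs g Q" "strict_mono (s::nat \<Rightarrow> nat)"
  shows "conv_pair (\<lambda>k. gs (s k)) (\<lambda>k. Qs (s k)) g Q"
proof -
  have s: "filterlim s sequentially sequentially" by (rule filterlim_subseq[OF assms(2)])
  have "AE x in lborel. (\<lambda>k. gs k x) \<longlonglongrightarrow> g x"
    using assms(1) by (auto simp: conv_pair_def)
  then have "AE x in lborel. (\<lambda>k. gs (s k) x) \<longlonglongrightarrow> g x"
    by eventually_elim (rule filterlim_compose[OF _ s])
  moreover have "AE x in lborel. \<forall>\<^sub>F k in sequentially. Qs k x = Q x"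
    using assms(1) by (auto simp: conv_pair_def)
  then have "AE x in lborel. \<forall>\<^sub>F k in sequentially. Qs (s k) x = Q x"
    by eventually_elim (rule eventually_compose_filterlim[OF _ s])
  ultimately show ?thesis using assms(1) by (auto simp: conv_pair_def)
qed

lemma cell_measurable:
  "Q \<in> borel \<rightarrow>\<^sub>M count_space UNIV \<Longrightarrow> Q -` {m::nat} \<in> sets (borel :: 'a::euclidean_space measure)"
  using measurable_sets[of Q borel "count_space UNIV" "{m}"] by simp

text \<open>The two uses are \<open>b\<close> = 1, which gives the cell masses, and \<open>b\<close>
  = \<open>phi z\<close>, which gives the numerator of the posterior density at
  \<open>z\<close>.\<close>

lemma cell_integral_tendsto:
  fixes b :: "'a::euclidean_space \<Rightarrow> real"
  assumes cp: "conv_pair gs Qs g Q" and b [measurable]: "b \<in> borel_measurable borel"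
    and bnd: "\<And>x. 0 \<le> b x \<and> b x \<le> C"
  shows "(\<lambda>k. \<integral>\<^sup>+ x. ennreal (b x) * indicator (Qs k -` {m}) x \<partial>density lborel (gs k)) \<longlonglongrightarrow>
    (\<integral>\<^sup>+ x. ennreal (b x) * indicator (Q -` {m}) x \<partial>density lborel g)"
proof -
  have gs: "prob_density (gs k)" for k using cp by (simp add: conv_pair_def)
  have g: "prob_density g" using cp by (simp add: conv_pair_def)
  note [measurable] = prob_density_measurable[OF g] prob_density_measurable[OF gs]
  have cells [measurable]: "Qs k -` {m} \<in> sets borel" "Q -` {m} \<in> sets borel" for k
    using cp by (auto simp: conv_pair_def intro!: cell_measurable)
  have C0: "0 \<le> C" using bnd by (meson order_trans)
  have eq: "(\<integral>\<^sup>+ x. ennreal (b x) * indicator A x \<partial>density lborel p) =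
      (\<integral>\<^sup>+ x. ennreal (b x * indicat_real A x) * p x \<partial>lborel)"
    if [measurable]: "A \<in> sets borel" "p \<in> borel_measurable borel" for A p
    using bnd by (subst nn_integral_density) (auto intro!: nn_integral_cong simp: indicator_def mult.commute)
  have "AE x in lborel. \<forall>\<^sub>F k in sequentially. Qs k x = Q x"
    using cp by (simp add: conv_pair_def)
  then have lim: "AE x in lborel. (\<lambda>k. b x * indicat_real (Qs k -` {m}) x) \<longlonglongrightarrow> b x * indicat_real (Q -` {m}) x"
  proof eventually_elim
    case (elim x)
    have "\<forall>\<^sub>F k in sequentially. b x * indicat_real (Qs k -` {m}) x = b x * indicat_real (Q -` {m}) x"
      using elim by eventually_elim (simp add: indicator_def)
    then show ?case by (rule tendsto_eventually)
  qed
  have "(\<lambda>k. \<integral>\<^sup>+ x. ennreal (b x * indicat_real (Qs k -` {m}) x) * gs k x \<partial>lborel) \<longlonglongrightarrow>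
    (\<integral>\<^sup>+ x. ennreal (b x * indicat_real (Q -` {m}) x) * g x \<partial>lborel)"
  proof (rule weighted_integral_tendsto[OF g gs _ _ _ _ _ lim])
    show "AE x in lborel. (\<lambda>k. gs k x) \<longlonglongrightarrow> g x" using cp by (simp add: conv_pair_def)
    show "0 \<le> b x * indicat_real A x \<and> b x * indicat_real A x \<le> C" for A x
      using bnd[of x] C0 by (auto simp: indicator_def)
    then show "0 \<le> b x * indicat_real A x \<and> b x * indicat_real A x \<le> C" for A x .
  qed measurable
  then show ?thesis by (simp add: eq)
qed

lemma cell_mass_tendsto:
  assumes cp: "conv_pair gs Qs g Q"
  shows "(\<lambda>k. emeasure (density lborel (gs k)) (Qs k -` {m})) \<longlonglongrightarrow> emeasure (density lborel g) (Q -` {m})"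
proof -
  have cells [measurable]: "Qs k -` {m} \<in> sets borel" "Q -` {m} \<in> sets borel" for k
    using cp by (auto simp: conv_pair_def intro!: cell_measurable)
  show ?thesis
    using cell_integral_tendsto[OF cp, of "\<lambda>_. 1" 1 m] by simp
qed

text \<open>Weights here vary with k and may be unbounded, so only an inequality survives; it serves
  for squared distances to a moving centre, whose limit may be infinite everywhere.\<close>

lemma cell_Fatou:
  assumes cp: "conv_pair gs Qs g Q" and as [measurable]: "\<And>k. as k \<in> borel_measurable borel"
    and a [measurable]: "a \<in> borel_measurable borel"
    and lim: "\<And>x. (\<lambda>k. as k x) \<longlonglongrightarrow> a x"
  shows "(\<integral>\<^sup>+ x. a x * indicator (Q -` {m}) x \<partial>density lborel g) \<le>
    liminf (\<lambda>k. \<integral>\<^sup>+ x. as k x * indicator (Qs k -` {m}) x \<partial>density lborel (gs k))"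
proof -
  have gs: "prob_density (gs k)" for k using cp by (simp add: conv_pair_def)
  have g: "prob_density g" using cp by (simp add: conv_pair_def)
  note [measurable] = prob_density_measurable[OF g] prob_density_measurable[OF gs]
  have cells [measurable]: "Qs k -` {m} \<in> sets borel" "Q -` {m} \<in> sets borel" for k
    using cp by (auto simp: conv_pair_def intro!: cell_measurable)
  have "AE x in lborel. \<forall>\<^sub>F k in sequentially. Qs k x = Q x"
    using cp by (simp add: conv_pair_def)
  then have lim': "AE x in lborel. (\<lambda>k. as k x * indicator (Qs k -` {m}) x) \<longlonglongrightarrow> a x * indicator (Q -` {m}) x"
  proof eventually_elim
    case (elim x)
    have "(\<lambda>k. as k x * indicator (Q -` {m}) x) \<longlonglongrightarrow> a x * indicator (Q -` {m}) x"
      using lim by (auto simp: indicator_def)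
    moreover have "\<forall>\<^sub>F k in sequentially. as k x * indicator (Q -` {m}) x = as k x * indicator (Qs k -` {m}) x"
      using elim by eventually_elim (simp add: indicator_def)
    ultimately show ?case by (rule Lim_transform_eventually)
  qed
  have lim_g: "AE x in lborel. (\<lambda>k. gs k x) \<longlonglongrightarrow> g x"
    using cp by (simp add: conv_pair_def)
  show ?thesis
    using Fatou_weighted[OF g _ _ lim_g lim'] by (simp add: nn_integral_density mult.commute)
qed

text \<open>Near-minimizing \<open>u\<close> either subconverge, or escape to infinity, in which case Fatou's
  lemma forces the limit to be infinite.\<close>

lemma cell_distortion_lsc:
  assumes cp: "conv_pair gs Qs g Q"
    and lim: "(\<lambda>k. INF u. \<integral>\<^sup>+ x. ennreal ((norm (x - u))\<^sup>2) * indicator (Qs k -` {m}) x \<partial>density lborel (gs k)) \<longlonglongrightarrow> l"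
  shows "(INF u. \<integral>\<^sup>+ x. ennreal ((norm (x - u))\<^sup>2) * indicator (Q -` {m}) x \<partial>density lborel g) \<le> l"
proof -
  define F where "F k u = (\<integral>\<^sup>+ x. ennreal ((norm (x - u))\<^sup>2) * indicator (Qs k -` {m}) x \<partial>density lborel (gs k))" for k u
  have cell [measurable]: "Q -` {m} \<in> sets borel"
    using cp by (auto simp: conv_pair_def intro!: cell_measurable)
  \<comment> \<open>The infimum is not known to be attained, so a slack 1 / (k + 1) is allowed; an
    infinite infimum is met by any centre.\<close>
  have "\<exists>u. F k u \<le> (INF u. F k u) + ennreal (1 / Suc k)" for k
  proof (cases "(INF u. F k u) = \<infinity>")
    case False
    then have "(INF u. F k u) < (INF u. F k u) + ennreal (1 / Suc k)"
      by (cases "INF u. F k u")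
        (auto simp: ennreal_plus[symmetric] ennreal_less_iff simp del: ennreal_plus)
    then show ?thesis unfolding INF_less_iff using less_imp_le by blast
  qed auto
  then obtain u where u: "\<And>k. F k (u k) \<le> (INF u. F k u) + ennreal (1 / Suc k)" by metis
  have "(\<lambda>k. (INF u. F k u) + ennreal (1 / Suc k)) \<longlonglongrightarrow> l + ennreal 0"
    using lim unfolding F_def[symmetric]
    by (intro tendsto_add tendsto_ennrealI LIMSEQ_Suc[OF lim_const_over_n])
  then have bound: "(\<lambda>k. (INF u. F k u) + ennreal (1 / Suc k)) \<longlonglongrightarrow> l" by simp
  have *: "(\<integral>\<^sup>+ x. a x * indicator (Q -` {m}) x \<partial>density lborel g) \<le> l"
    if s: "strict_mono (s::nat \<Rightarrow> nat)" and [measurable]: "a \<in> borel_measurable borel"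
      and a: "\<And>x. (\<lambda>k. ennreal ((norm (x - u (s k)))\<^sup>2)) \<longlonglongrightarrow> a x" for s a
  proof -
    have "(\<integral>\<^sup>+ x. a x * indicator (Q -` {m}) x \<partial>density lborel g) \<le> liminf (\<lambda>k. F (s k) (u (s k)))"
      unfolding F_def by (rule cell_Fatou[OF conv_pair_subseq[OF cp s] _ _ a]) auto
    also have "\<dots> \<le> liminf (\<lambda>k. (INF u. F (s k) u) + ennreal (1 / Suc (s k)))"
      by (intro Liminf_mono always_eventually allI u)
    also have "\<dots> = l"
      using LIMSEQ_subseq_LIMSEQ[OF bound s] by (intro lim_imp_Liminf) (auto simp: o_def)
    finally show ?thesis .
  qed
  obtain s e where s: "strict_mono (s::nat \<Rightarrow> nat)" and e: "(\<lambda>k. ennreal (norm (u (s k)))) \<longlonglongrightarrow> e"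
    using compact_complete_linorder[of "\<lambda>k. ennreal (norm (u k))"] by (auto simp: o_def)
  show ?thesis
  proof (cases "e = \<infinity>")
    case True
    then have inf: "filterlim (\<lambda>k. norm (u (s k))) at_top sequentially"
      using e by (simp add: ennreal_tendsto_top_eq_at_top)
    have "(\<lambda>k. ennreal ((norm (x - u (s k)))\<^sup>2)) \<longlonglongrightarrow> \<infinity>" for x
    proof -
      have "filterlim (\<lambda>k. - norm x + norm (u (s k))) at_top sequentially"
        by (rule filterlim_tendsto_add_at_top[OF tendsto_const inf])
      then have "filterlim (\<lambda>k. norm (x - u (s k))) at_top sequentially"
      proof (rule filterlim_at_top_mono, intro always_eventually allI)
        show "- norm x + norm (u (s k)) \<le> norm (x - u (s k))" for k
          using norm_triangle_ineq2[of "u (s k)" x] by (simp add: norm_minus_commute)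
      qed
      then have "filterlim (\<lambda>k. (norm (x - u (s k)))\<^sup>2) at_top sequentially"
        by (intro filterlim_pow_at_top) auto
      then show ?thesis by (simp add: ennreal_tendsto_top_eq_at_top)
    qed
    \<comment> \<open>An infinite weight on the limit cell leaves only two cases, a null cell or l =
      \<infinity>.\<close>
    then have inf_l: "\<infinity> * emeasure (density lborel g) (Q -` {m}) \<le> l"
      using *[OF s, of "\<lambda>_. \<infinity>"] by (simp add: nn_integral_cmult_indicator)
    show ?thesis
    proof (cases "emeasure (density lborel g) (Q -` {m}) = 0")
      case True
      then have "(\<integral>\<^sup>+ x. ennreal ((norm (x - 0))\<^sup>2) * indicator (Q -` {m}) x \<partial>density lborel g) = 0"
        by (intro nn_integral_null_set) (auto intro: null_setsI)
      then show ?thesis by (intro INF_lower2[of 0]) (simp_all only: UNIV_I zero_le)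
    next
      case False
      then show ?thesis using inf_l by (simp add: ennreal_top_mult top_unique)
    qed
  next
    case False
    then obtain e' where e': "0 \<le> e'" "e = ennreal e'" by (cases e) auto
    then have "(\<lambda>k. norm (u (s k))) \<longlonglongrightarrow> e'"
      using e by (simp add: tendsto_ennreal_iff)
    then have "Bseq (\<lambda>k. norm (u (s k)))" by (intro convergent_imp_Bseq convergentI)
    then have "bounded (range (\<lambda>k. u (s k)))" by (simp add: Bseq_eq_bounded bounded_iff)
    then obtain u' r where r: "strict_mono (r::nat \<Rightarrow> nat)" and u': "(\<lambda>k. u (s (r k))) \<longlonglongrightarrow> u'"
      using bounded_imp_convergent_subsequence[of "\<lambda>k. u (s k)"] by (auto simp: o_def)
    have "(\<integral>\<^sup>+ x. ennreal ((norm (x - u'))\<^sup>2) * indicator (Q -` {m}) x \<partial>density lborel g) \<le> l"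
      using strict_mono_o[OF s r]
      by (intro *[where s = "s \<circ> r"]) (auto intro!: tendsto_intros u')
    then show ?thesis by (rule INF_lower2[OF UNIV_I])
  qed
qed

section \<open>Dynamic programming\<close>

text \<open>A null cell enters with the factor 0, and 0 * \<infinity> = 0, so the continuation value
  at its posterior, which comes from a division by zero, never counts.\<close>

lemma stage_val_cong:
  assumes "\<And>m. m \<in> {1..M} \<Longrightarrow> emeasure \<pi> (Q -` {m}) \<noteq> 0 \<Longrightarrow>
    V (belief_update phi m \<pi> Q) = V' (belief_update phi m \<pi> Q)"
  shows "stage_val phi M T V \<pi> Q = stage_val phi M T V' \<pi> Q"
  unfolding stage_val_def using assms
  by (intro arg_cong2[of _ _ _ _ "(+)"] sum.cong refl) (metis mult_zero_left)

lemma stage_val_mono: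
  assumes "\<And>m. m \<in> {1..M} \<Longrightarrow> emeasure \<pi> (Q -` {m}) \<noteq> 0 \<Longrightarrow>
    V (belief_update phi m \<pi> Q) \<le> V' (belief_update phi m \<pi> Q)"
  shows "stage_val phi M T V \<pi> Q \<le> stage_val phi M T V' \<pi> Q"
  unfolding stage_val_def
proof (intro add_left_mono sum_mono)
  fix m assume "m \<in> {1..M}"
  then show "emeasure \<pi> (Q -` {m}) * V (belief_update phi m \<pi> Q)
      \<le> emeasure \<pi> (Q -` {m}) * V' (belief_update phi m \<pi> Q)"
    using assms by (cases "emeasure \<pi> (Q -` {m}) = 0") (auto intro: mult_left_mono)
qed

lemma const_in_Qc: "1 \<le> M \<Longrightarrow> (\<lambda>_. 1) \<in> Qc M"
proof -
  have "(\<lambda>_::'a. 1::nat) -` {i} = (if i = 1 then UNIV else {})" for i by auto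
  then show "1 \<le> M \<Longrightarrow> (\<lambda>_::'a. 1) \<in> Qc M" by (auto simp: Qc_def)
qed

lemma Qc_measurable: "Q \<in> Qc M \<Longrightarrow> Q \<in> borel \<rightarrow>\<^sub>M count_space UNIV"
  by (simp add: Qc_def)

text \<open>Phrased with convergent values instead of a limit inferior: every sequence in
  \<open>ennreal\<close> has a convergent subsequence, so such limits can always be
  arranged.\<close>

definition seq_lsc :: "('a::euclidean_space measure \<Rightarrow> ennreal) \<Rightarrow> bool" where
  "seq_lsc V \<longleftrightarrow> (\<forall>gs g L. (\<forall>k. prob_density (gs k)) \<longrightarrow> prob_density g \<longrightarrow>
     (AE x in lborel. (\<lambda>k. gs k x) \<longlonglongrightarrow> g x) \<longrightarrow>
     (\<lambda>k. V (density lborel (gs k))) \<longlonglongrightarrow> L \<longrightarrow> V (density lborel g) \<le> L)"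

section \<open>Lower semicontinuity of stage values and value functions\<close>

locale transition_density =
  fixes phi :: "'a::euclidean_space \<Rightarrow> 'a \<Rightarrow> real" and C :: real
  assumes phi_measurable [measurable]: "(\<lambda>(z, x). phi z x) \<in> borel_measurable (borel \<Otimes>\<^sub>M borel)"
    and phi_bounds: "0 \<le> phi z x" "phi z x \<le> C"
    and phi_integral: "(\<integral>\<^sup>+ z. ennreal (phi z x) \<partial>lborel) = 1"
begin

text \<open>By Tonelli the numerator integrates over z to the cell mass, as \<open>phi z x\<close>
  has integral one in z. The prior may be any Borel probability measure, in particular a point
  mass.\<close>

lemma belief_prob_density:
  fixes m :: nat
  assumes "prob_space \<pi>" and sets [measurable_cong]: "sets \<pi> = sets borel"
    and Q: "Q \<in> borel \<rightarrow>\<^sub>M count_space UNIV" and p: "emeasure \<pi> (Q -` {m}) \<noteq> 0"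
  shows "prob_density (\<lambda>z. (\<integral>\<^sup>+ x. ennreal (phi z x) * indicator (Q -` {m}) x \<partial>\<pi>) / emeasure \<pi> (Q -` {m}))"
proof -
  interpret prob_space \<pi> by fact
  interpret pair_sigma_finite lborel \<pi> ..
  have [measurable]: "Q -` {m} \<in> sets borel" using Q by (rule cell_measurable)
  have meas [measurable]: "(\<lambda>(z, x). ennreal (phi z x) * indicator (Q -` {m}) x) \<in> borel_measurable (lborel \<Otimes>\<^sub>M \<pi>)"
    by measurable
  have [measurable]: "(\<lambda>z. \<integral>\<^sup>+ x. ennreal (phi z x) * indicator (Q -` {m}) x \<partial>\<pi>) \<in> borel_measurable borel"
    by measurable
  have "(\<integral>\<^sup>+ z. \<integral>\<^sup>+ x. ennreal (phi z x) * indicator (Q -` {m}) x \<partial>\<pi> \<partial>lborel)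
      = (\<integral>\<^sup>+ x. \<integral>\<^sup>+ z. ennreal (phi z x) * indicator (Q -` {m}) x \<partial>lborel \<partial>\<pi>)"
    by (rule Fubini'[symmetric]) measurable
  also have "\<dots> = (\<integral>\<^sup>+ x. indicator (Q -` {m}) x \<partial>\<pi>)"
    by (intro nn_integral_cong) (simp add: nn_integral_multc phi_integral)
  also have "\<dots> = emeasure \<pi> (Q -` {m})" by simp
  finally have "(\<integral>\<^sup>+ z. \<integral>\<^sup>+ x. ennreal (phi z x) * indicator (Q -` {m}) x \<partial>\<pi> \<partial>lborel) = emeasure \<pi> (Q -` {m})" .
  moreover have "emeasure \<pi> (Q -` {m}) / emeasure \<pi> (Q -` {m}) = 1"
    using p by (intro ennreal_divide_self) (auto simp: less_top[symmetric])
  ultimately show ?thesis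
    by (simp add: prob_density_def nn_integral_divide)
qed

text \<open>Convergence holds at every z, not only almost everywhere: for fixed z, numerator and
  denominator are cell integrals of bounded functions.\<close>

lemma belief_tendsto:
  assumes cp: "conv_pair gs Qs g Q" and p: "emeasure (density lborel g) (Q -` {m}) \<noteq> 0"
  shows "(\<lambda>k. (\<integral>\<^sup>+ x. ennreal (phi z x) * indicator (Qs k -` {m}) x \<partial>density lborel (gs k))
        / emeasure (density lborel (gs k)) (Qs k -` {m})) \<longlonglongrightarrow>
    (\<integral>\<^sup>+ x. ennreal (phi z x) * indicator (Q -` {m}) x \<partial>density lborel g) / emeasure (density lborel g) (Q -` {m})"
proof -
  have "prob_space (density lborel g)"
    using cp prob_density_iff_prob_space[of g] by (auto simp: conv_pair_def prob_density_def)
  then interpret prob_space "density lborel g" .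
  have "(\<lambda>k. inverse (emeasure (density lborel (gs k)) (Qs k -` {m}))) \<longlonglongrightarrow> inverse (emeasure (density lborel g) (Q -` {m}))"
    by (rule continuous_on_tendsto_compose[OF continuous_on_inverse_ennreal[OF continuous_on_id[of UNIV]]
          cell_mass_tendsto[OF cp]]) auto
  moreover have "(\<lambda>k. \<integral>\<^sup>+ x. ennreal (phi z x) * indicator (Qs k -` {m}) x \<partial>density lborel (gs k)) \<longlonglongrightarrow>
    (\<integral>\<^sup>+ x. ennreal (phi z x) * indicator (Q -` {m}) x \<partial>density lborel g)"
    by (rule cell_integral_tendsto[OF cp, where C = C]) (auto simp: phi_bounds)
  ultimately show ?thesis
    unfolding divide_ennreal_def
    using p emeasure_finite[of "Q -` {m}"] by (intro tendsto_mult_ennreal) (auto simp: ennreal_inverse_eq_0_iff)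
qed

lemma continuation_lsc:
  assumes V: "seq_lsc V" and cp: "conv_pair gs Qs g Q"
    and lim: "(\<lambda>k. emeasure (density lborel (gs k)) (Qs k -` {m}) * V (belief_update phi m (density lborel (gs k)) (Qs k))) \<longlonglongrightarrow> l"
  shows "emeasure (density lborel g) (Q -` {m}) * V (belief_update phi m (density lborel g) Q) \<le> l"
proof (cases "emeasure (density lborel g) (Q -` {m}) = 0")
  case False
  have prob: "prob_space (density lborel p)" if "prob_density p" for p :: "'a \<Rightarrow> ennreal"
    using that prob_density_iff_prob_space[of p] by (auto simp: prob_density_def)
  interpret prob_space "density lborel g" using cp by (intro prob) (simp add: conv_pair_def)
  have "\<forall>\<^sub>F k in sequentially. 0 < emeasure (density lborel (gs k)) (Qs k -` {m})"
    using False by (intro order_tendstoD(1)[OF cell_mass_tendsto[OF cp]]) (simp add: zero_less_iff_neq_zero)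
  \<comment> \<open>The first \<open>N\<close> indices are dropped, because the posterior of a null
    cell need not be a probability density.\<close>
  then obtain N where N: "\<And>k. k \<ge> N \<Longrightarrow> emeasure (density lborel (gs k)) (Qs k -` {m}) \<noteq> 0"
    by (auto simp: eventually_sequentially zero_less_iff_neq_zero)
  obtain s e where s: "strict_mono (s::nat \<Rightarrow> nat)"
    and e: "(\<lambda>k. V (belief_update phi m (density lborel (gs (s k + N))) (Qs (s k + N)))) \<longlonglongrightarrow> e"
    using compact_complete_linorder[of "\<lambda>k. V (belief_update phi m (density lborel (gs (k + N))) (Qs (k + N)))"]
    by (auto simp: o_def)
  have t: "strict_mono (\<lambda>k. s k + N)" using s by (simp add: strict_mono_def)
  note cp' = conv_pair_subseq[OF cp t]
  have "V (belief_update phi m (density lborel g) Q) \<le> e"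
    unfolding belief_update_def
  proof (rule V[unfolded seq_lsc_def, rule_format])
    show "prob_density (\<lambda>z. (\<integral>\<^sup>+ x. ennreal (phi z x) * indicator (Qs (s k + N) -` {m}) x \<partial>density lborel (gs (s k + N)))
        / emeasure (density lborel (gs (s k + N))) (Qs (s k + N) -` {m}))" for k
      using cp N by (intro belief_prob_density prob) (auto simp: conv_pair_def)
    show "prob_density (\<lambda>z. (\<integral>\<^sup>+ x. ennreal (phi z x) * indicator (Q -` {m}) x \<partial>density lborel g)
        / emeasure (density lborel g) (Q -` {m}))"
      using cp False by (intro belief_prob_density prob) (auto simp: conv_pair_def)
  qed (use belief_tendsto[OF cp' False] e in \<open>auto simp: belief_update_def\<close>)
  \<comment> \<open>The limit mass is positive and finite, so the product of the limits avoids 0 *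
    \<infinity> and must be the given limit \<open>l\<close>.\<close>
  moreover have "(\<lambda>k. emeasure (density lborel (gs (s k + N))) (Qs (s k + N) -` {m})
      * V (belief_update phi m (density lborel (gs (s k + N))) (Qs (s k + N)))) \<longlonglongrightarrow>
    emeasure (density lborel g) (Q -` {m}) * e"
    using False emeasure_finite[of "Q -` {m}"]
    by (intro tendsto_mult_ennreal cell_mass_tendsto[OF cp'] e) auto
  then have "emeasure (density lborel g) (Q -` {m}) * e = l"
    using LIMSEQ_unique LIMSEQ_subseq_LIMSEQ[OF lim t] by (fastforce simp: o_def)
  ultimately show ?thesis by (metis mult_left_mono zero_le)
qed simp

lemma stage_val_lsc:
  assumes V: "seq_lsc V" and cp: "conv_pair gs Qs g Q" and T: "1 \<le> T"
    and lim: "(\<lambda>k. stage_val phi M T V (density lborel (gs k)) (Qs k)) \<longlonglongrightarrow> L"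
  shows "stage_val phi M T V (density lborel g) Q \<le> L"
proof -
  define D where "D i \<pi> Q = (INF u. \<integral>\<^sup>+ x. ennreal ((norm (x - u))\<^sup>2) * indicator (Q -` {i}) x \<partial>\<pi>)"
    for i :: nat and \<pi> :: "'a measure" and Q
  define E where "E m \<pi> Q = emeasure \<pi> (Q -` {m}) * V (belief_update phi m \<pi> Q)"
    for m :: nat and \<pi> :: "'a measure" and Q
  \<comment> \<open>The flag selects the distortion (\<open>True\<close>) or the continuation term
    (\<open>False\<close>), so that one common subsequence makes all 2M summands converge
    separately.\<close>
  define X where "X p k = (if snd p then D (fst p) (density lborel (gs k)) (Qs k)
    else E (fst p) (density lborel (gs k)) (Qs k))" for p :: "nat \<times> bool" and k
  have sv: "stage_val phi M T V \<pi> Q = inverse (of_nat T) * (\<Sum>i\<in>{1..M}. D i \<pi> Q) + (\<Sum>m\<in>{1..M}. E m \<pi> Q)" for \<pi> Q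
    by (simp add: stage_val_def qcost_def D_def E_def divide_ennreal_def mult.commute)
  have "\<exists>r l. strict_mono r \<and> (\<lambda>k. X p (s (r k))) \<longlonglongrightarrow> l" for p and s :: "nat \<Rightarrow> nat"
    using compact_complete_linorder[of "\<lambda>k. X p (s k)"] by (auto simp: o_def)
  then have "\<exists>r l. strict_mono (r::nat \<Rightarrow> nat) \<and> (\<forall>p\<in>{1..M} \<times> UNIV. (\<lambda>k. X p (r k)) \<longlonglongrightarrow> l p)"
    by (intro common_convergent_subseq) simp_all
  then obtain r l where r: "strict_mono (r::nat \<Rightarrow> nat)"
    and l: "\<And>p. p \<in> {1..M} \<times> UNIV \<Longrightarrow> (\<lambda>k. X p (r k)) \<longlonglongrightarrow> l p"
    by blast
  note cp' = conv_pair_subseq[OF cp r]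
  have lD: "(\<lambda>k. D i (density lborel (gs (r k))) (Qs (r k))) \<longlonglongrightarrow> l (i, True)" if "i \<in> {1..M}" for i
    using l[of "(i, True)"] that by (simp add: X_def)
  have lE: "(\<lambda>k. E i (density lborel (gs (r k))) (Qs (r k))) \<longlonglongrightarrow> l (i, False)" if "i \<in> {1..M}" for i
    using l[of "(i, False)"] that by (simp add: X_def)
  have Tinv: "inverse (of_nat T :: ennreal) < \<top>"
    using T by (simp add: top.not_eq_extremum[symmetric])
  have "(\<lambda>k. stage_val phi M T V (density lborel (gs (r k))) (Qs (r k))) \<longlonglongrightarrow>
      inverse (of_nat T) * (\<Sum>i\<in>{1..M}. l (i, True)) + (\<Sum>m\<in>{1..M}. l (m, False))"
    unfolding sv by (intro tendsto_add ennreal_tendsto_cmult Tinv tendsto_sum lD lE)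
  then have "L = inverse (of_nat T) * (\<Sum>i\<in>{1..M}. l (i, True)) + (\<Sum>m\<in>{1..M}. l (m, False))"
    using LIMSEQ_unique LIMSEQ_subseq_LIMSEQ[OF lim r] by (fastforce simp: o_def)
  moreover have "D i (density lborel g) Q \<le> l (i, True)" if "i \<in> {1..M}" for i
    using cell_distortion_lsc[OF cp' lD[OF that, unfolded D_def]] by (simp add: D_def)
  moreover have "E i (density lborel g) Q \<le> l (i, False)" if "i \<in> {1..M}" for i
    using continuation_lsc[OF V cp' lE[OF that, unfolded E_def]] by (simp add: E_def)
  ultimately show ?thesis
    unfolding sv by (auto intro!: add_mono mult_left_mono sum_mono)
qed

text \<open>Applied to a constant sequence of densities it yields minimizers; applied to varying
  densities with their minimizers it carries lower semicontinuity to the preceding stage.\<close>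

lemma limit_quantizer:
  assumes V: "seq_lsc V" and T: "1 \<le> T"
    and gs: "\<And>k. prob_density (gs k)" and g: "prob_density g"
    and lim: "AE x in lborel. (\<lambda>k. gs k x) \<longlonglongrightarrow> g x"
    and Qs: "\<And>k. Qs k \<in> Qc M"
    and L: "(\<lambda>k. stage_val phi M T V (density lborel (gs k)) (Qs k)) \<longlonglongrightarrow> L"
  shows "\<exists>Q\<in>Qc M. stage_val phi M T V (density lborel g) Q \<le> L"
proof -
  obtain r Q where r: "strict_mono (r::nat \<Rightarrow> nat)" and Q: "Q \<in> Qc M"
    and ae: "AE x in lborel. \<forall>\<^sub>F k in sequentially. Qs (r k) x = Q x"
    using Qc_sequentially_compact[of Qs M, OF Qs] by blast
  have "AE x in lborel. (\<lambda>k. gs (r k) x) \<longlonglongrightarrow> g x"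
    using lim by eventually_elim (rule filterlim_compose[OF _ filterlim_subseq[OF r]])
  then have "conv_pair (\<lambda>k. gs (r k)) (\<lambda>k. Qs (r k)) g Q"
    using gs g ae Qs Q by (auto simp: conv_pair_def intro: Qc_measurable)
  from stage_val_lsc[OF V this T] LIMSEQ_subseq_LIMSEQ[OF L r] Q show ?thesis
    by (auto simp: o_def)
qed

lemma minimizer_exists:
  assumes V: "seq_lsc V" and T: "1 \<le> T" and M: "1 \<le> M" and g: "prob_density g"
  shows "\<exists>Q\<in>Qc M. stage_val phi M T V (density lborel g) Q = (INF Q\<in>Qc M. stage_val phi M T V (density lborel g) Q)"
proof -
  let ?s = "stage_val phi M T V (density lborel g)"
  have "?s ` Qc M \<noteq> {}" using const_in_Qc[OF M] by blast
  from ennreal_Inf_countable_INF[OF this] obtain F :: "nat \<Rightarrow> ennreal" where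
    F: "decseq F" "range F \<subseteq> ?s ` Qc M" "(INF Q\<in>Qc M. ?s Q) = (INF k. F k)" by auto
  then have "\<forall>k. \<exists>Q\<in>Qc M. F k = ?s Q" by blast
  then obtain Qs where Qs: "\<And>k. Qs k \<in> Qc M" "\<And>k. F k = ?s (Qs k)" by metis
  have "(\<lambda>k. ?s (Qs k)) \<longlonglongrightarrow> (INF Q\<in>Qc M. ?s Q)"
    unfolding F(3) Qs(2)[symmetric] by (rule LIMSEQ_INF[OF F(1)])
  then obtain Q where "Q \<in> Qc M" "?s Q \<le> (INF Q\<in>Qc M. ?s Q)"
    using limit_quantizer[where Qs = Qs, OF V T g g _ Qs(1)] by auto
  then show ?thesis by (meson INF_lower antisym)
qed

lemma seq_lsc_dpV:
  assumes T: "1 \<le> T" and M: "1 \<le> M"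
  shows "seq_lsc (dpV phi M T n)"
proof (induction n)
  case 0
  then show ?case by (simp add: seq_lsc_def)
next
  case (Suc n)
  show ?case
    unfolding seq_lsc_def
  proof (intro allI impI)
    fix gs and g :: "'a \<Rightarrow> ennreal" and L
    assume gs: "\<forall>k. prob_density (gs k)" and g: "prob_density g"
      and lim: "AE x in lborel. (\<lambda>k. gs k x) \<longlonglongrightarrow> g x"
      and L: "(\<lambda>k. dpV phi M T (Suc n) (density lborel (gs k))) \<longlonglongrightarrow> L"
    have "\<exists>Q\<in>Qc M. stage_val phi M T (dpV phi M T n) (density lborel (gs k)) Q =
        dpV phi M T (Suc n) (density lborel (gs k))" for k
      using minimizer_exists[OF Suc T M] gs by simp
    then obtain Qs where Qs: "\<And>k. Qs k \<in> Qc M"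
      "\<And>k. stage_val phi M T (dpV phi M T n) (density lborel (gs k)) (Qs k) =
        dpV phi M T (Suc n) (density lborel (gs k))" by metis
    have "\<exists>Q\<in>Qc M. stage_val phi M T (dpV phi M T n) (density lborel g) Q \<le> L"
      using gs by (intro limit_quantizer[where Qs = Qs, OF Suc T _ g lim Qs(1), unfolded Qs(2), OF _ L]) simp
    then show "dpV phi M T (Suc n) (density lborel g) \<le> L"
      by (auto intro: INF_lower2)
  qed
qed

text \<open>The centre \<open>x0\<close> has zero distortion, and only the cell containing
  \<open>x0\<close> has mass; its posterior is the transition law from \<open>x0\<close>, whichever
  cell this is.\<close>

lemma stage_val_return:
  assumes "Q \<in> Qc M"
  shows "stage_val phi M T V (return borel x0) Q = V (density lborel (\<lambda>z. ennreal (phi z x0)))"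
proof -
  have range: "Q x0 \<in> {1..M}" using assms by (auto simp: Qc_def)
  have cell [measurable]: "Q -` {m} \<in> sets borel" for m
    using assms by (auto intro: cell_measurable Qc_measurable)
  have phi1 [measurable]: "phi z \<in> borel_measurable borel" for z by measurable
  have div1: "ennreal (phi z x0) / 1 = ennreal (phi z x0)" for z
    using divide_ennreal[of "phi z x0" 1] phi_bounds by simp
  have "qcost M (return borel x0) Q = 0"
    unfolding qcost_def
  proof (intro sum.neutral ballI)
    fix i
    have "(INF u. \<integral>\<^sup>+ x. ennreal ((norm (x - u))\<^sup>2) * indicator (Q -` {i}) x \<partial>return borel x0)
      \<le> (\<integral>\<^sup>+ x. ennreal ((norm (x - x0))\<^sup>2) * indicator (Q -` {i}) x \<partial>return borel x0)"
      by (rule INF_lower) simp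
    also have "\<dots> = 0" by (subst nn_integral_return) auto
    finally show "(INF u. \<integral>\<^sup>+ x. ennreal ((norm (x - u))\<^sup>2) * indicator (Q -` {i}) x \<partial>return borel x0) = 0"
      by simp
  qed
  moreover have "(\<Sum>m\<in>{1..M}. emeasure (return borel x0) (Q -` {m}) * V (belief_update phi m (return borel x0) Q))
      = (\<Sum>m\<in>{1..M}. if m = Q x0 then V (density lborel (\<lambda>z. ennreal (phi z x0))) else 0)"
    using div1 by (intro sum.cong) (auto simp: belief_update_def nn_integral_return)
  ultimately show ?thesis using range by (simp add: stage_val_def)
qed

text \<open>The class is closed under updates along cells of positive mass, contains both kinds of
  initial laws and all of \<open>S_class C C1\<close>, and admits a minimizer at each of its
  members.\<close>

definition good_belief :: "'a measure \<Rightarrow> bool" where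
  "good_belief \<pi> \<longleftrightarrow> (\<exists>g. prob_density g \<and> \<pi> = density lborel g) \<or> (\<exists>x0. \<pi> = return borel x0)"

lemma good_belief_prob: "good_belief \<pi> \<Longrightarrow> prob_space \<pi> \<and> sets \<pi> = sets borel"
  using prob_density_iff_prob_space prob_space_return[of _ borel]
  by (auto simp: good_belief_def prob_density_def)

lemma good_belief_update:
  assumes "prob_space \<pi>" "sets \<pi> = sets borel" "Q \<in> Qc M" "emeasure \<pi> (Q -` {m}) \<noteq> 0"
  shows "good_belief (belief_update phi m \<pi> Q)"
  unfolding good_belief_def belief_update_def
  using belief_prob_density[OF assms(1,2) Qc_measurable[OF assms(3)] assms(4)] by blast

lemma good_belief_minimizer:
  assumes "1 \<le> T" "1 \<le> M" "good_belief \<pi>"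
  shows "\<exists>Q\<in>Qc M. dpV phi M T (Suc n) \<pi> = stage_val phi M T (dpV phi M T n) \<pi> Q"
  using assms(3) unfolding good_belief_def
proof (elim disjE exE conjE)
  fix g assume "prob_density g" "\<pi> = density lborel g"
  then show ?thesis
    using minimizer_exists[OF seq_lsc_dpV[OF assms(1,2)] assms(1,2)] by (metis dpV.simps(2))
next
  fix x0 assume \<pi>: "\<pi> = return borel x0"
  show ?thesis
  proof (rule bexI)
    show "dpV phi M T (Suc n) \<pi> = stage_val phi M T (dpV phi M T n) \<pi> (\<lambda>_. 1)"
      using const_in_Qc[OF assms(2), where 'a = 'a] by (auto simp: \<pi> stage_val_return INF_constant)
  qed (rule const_in_Qc[OF assms(2)])
qed

text \<open>The infimum is at most the value of the quantizer that the policy picks, and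
  continuations are compared only after cells of positive mass, where the posterior is again a Borel
  probability measure.\<close>

lemma dpV_le_cost_to_go:
  assumes "\<eta> \<in> policies M" "prob_space \<pi>" "sets \<pi> = sets borel"
  shows "dpV phi M T n \<pi> \<le> cost_to_go phi M T \<eta> n t \<pi>"
  using assms(2,3)
proof (induction n arbitrary: t \<pi>)
  case (Suc n)
  have Q: "\<eta> t \<pi> \<in> Qc M"
    using assms(1) Suc.prems by (auto simp: policies_def space_prob_algebra)
  have "dpV phi M T (Suc n) \<pi> \<le> stage_val phi M T (dpV phi M T n) \<pi> (\<eta> t \<pi>)"
    using Q by (auto intro: INF_lower)
  also have "\<dots> \<le> stage_val phi M T (cost_to_go phi M T \<eta> n (Suc t)) \<pi> (\<eta> t \<pi>)"
    using good_belief_update[OF Suc.prems Q] good_belief_prob by (intro stage_val_mono Suc.IH) auto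
  finally show ?case by simp
qed simp

end

section \<open>Optimal policies\<close>

text \<open>Each other measure differs from \<open>p\<close> on some measurable set; prescribing the
  masses that \<open>p\<close> gives to these finitely many sets is a measurable condition, since
  evaluation at a set is measurable.\<close>

lemma separate_from_finite_prob_algebra:
  assumes "finite R" "p \<in> space (prob_algebra N)" "R \<subseteq> space (prob_algebra N)" "p \<notin> R"
  shows "\<exists>E\<in>sets (prob_algebra N). p \<in> E \<and> E \<inter> R = {}"
proof -
  have "\<exists>A\<in>sets N. emeasure p A \<noteq> emeasure q A" if "q \<in> R" for q
  proof (rule ccontr)
    assume "\<not> ?thesis"
    then have "p = q"
      using that assms by (intro measure_eqI) (auto simp: space_prob_algebra)
    then show False using that assms by simp
  qed
  then obtain A where A: "\<And>q. q \<in> R \<Longrightarrow> A q \<in> sets N" "\<And>q. q \<in> R \<Longrightarrow> emeasure p (A q) \<noteq> emeasure q (A q)"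
    by metis
  define E where "E = {\<pi> \<in> space (prob_algebra N). \<forall>q\<in>R. emeasure \<pi> (A q) = emeasure p (A q)}"
  have "(\<lambda>\<pi>. emeasure \<pi> (A q)) \<in> borel_measurable (prob_algebra N)" if "q \<in> R" for q
    by (rule measurable_compose[OF measurable_prob_algebraD[OF measurable_ident_sets[OF refl]]
          measurable_emeasure_subprob_algebra[OF A(1)[OF that]]])
  then have "E \<in> sets (prob_algebra N)"
    unfolding E_def using assms(1) by (intro sets.sets_Collect_finite_All) (auto intro!: borel_measurable_eq)
  moreover have "p \<in> E" "E \<inter> R = {}"
    using A(2) assms(2) by (auto simp: E_def) metis
  ultimately show ?thesis by blast
qed

text \<open>Starting from a constant quantizer, one belief at a time is overridden on a measurable
  set that avoids the beliefs already treated.\<close>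

lemma ex_measurable_quantizer_selection:
  assumes "finite R" "R \<subseteq> space (prob_algebra borel)" "\<And>\<pi>. \<pi> \<in> R \<Longrightarrow> q \<pi> \<in> Qc M" "1 \<le> M"
  shows "\<exists>e. (\<forall>\<pi>. e \<pi> \<in> Qc M) \<and> (\<forall>\<pi>\<in>R. e \<pi> = q \<pi>) \<and>
    (\<lambda>(\<pi>, x). e \<pi> x) \<in> prob_algebra (borel :: 'a::euclidean_space measure) \<Otimes>\<^sub>M borel \<rightarrow>\<^sub>M count_space UNIV"
  using assms(1-3)
proof (induction R rule: finite_induct)
  case empty
  show ?case using const_in_Qc[OF assms(4)] by (intro exI[of _ "\<lambda>_ _. 1"]) auto
next
  case (insert p R)
  then obtain e where e: "\<forall>\<pi>. e \<pi> \<in> Qc M" "\<forall>\<pi>\<in>R. e \<pi> = q \<pi>"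
    and [measurable]: "(\<lambda>(\<pi>, x). e \<pi> x) \<in> prob_algebra borel \<Otimes>\<^sub>M borel \<rightarrow>\<^sub>M count_space UNIV"
    by auto
  obtain E where E [measurable]: "E \<in> sets (prob_algebra borel)" and "p \<in> E" "E \<inter> R = {}"
    using separate_from_finite_prob_algebra[of R p borel] insert by auto
  have [measurable]: "q p \<in> borel \<rightarrow>\<^sub>M count_space UNIV"
    using insert.prems by (auto intro: Qc_measurable)
  have "(\<lambda>(\<pi>, x). (if \<pi> \<in> E then q p else e \<pi>) x) =
      (\<lambda>y. if fst y \<in> E then q p (snd y) else (\<lambda>(\<pi>, x). e \<pi> x) y)"
    by (auto simp: fun_eq_iff)
  also have "\<dots> \<in> prob_algebra borel \<Otimes>\<^sub>M borel \<rightarrow>\<^sub>M count_space UNIV" by measurable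
  finally have "(\<lambda>(\<pi>, x). (if \<pi> \<in> E then q p else e \<pi>) x) \<in> prob_algebra borel \<Otimes>\<^sub>M borel \<rightarrow>\<^sub>M count_space UNIV" .
  moreover have "\<forall>\<pi>\<in>insert p R. (if \<pi> \<in> E then q p else e \<pi>) = q \<pi>"
    using e(2) \<open>p \<in> E\<close> \<open>E \<inter> R = {}\<close> by auto
  ultimately show ?case
    using e(1) insert.prems(2) by (intro exI[of _ "\<lambda>\<pi>. if \<pi> \<in> E then q p else e \<pi>"]) auto
qed

text \<open>Every label is followed, including labels of probability zero, which keeps the set a
  finite image; meaningless posteriors are removed later by intersecting with
  \<open>good_belief\<close>.\<close>

primrec reachable_beliefs ::
  "('a::euclidean_space \<Rightarrow> 'a \<Rightarrow> real) \<Rightarrow> nat \<Rightarrow> (nat \<Rightarrow> 'a measure \<Rightarrow> 'a \<Rightarrow> nat) \<Rightarrow> 'a measure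
     \<Rightarrow> nat \<Rightarrow> 'a measure set" where
  "reachable_beliefs phi M q \<pi>0 0 = {\<pi>0}"
| "reachable_beliefs phi M q \<pi>0 (Suc t) =
     (\<lambda>(m, \<pi>). belief_update phi m \<pi> (q t \<pi>)) ` ({1..M} \<times> reachable_beliefs phi M q \<pi>0 t)"

lemma finite_reachable_beliefs: "finite (reachable_beliefs phi M q \<pi>0 t)"
  by (induction t) auto

context transition_density
begin

lemma optimal_policy_exists:
  assumes T: "1 \<le> T" and M: "1 \<le> M" and \<pi>0: "good_belief \<pi>0"
  shows "\<exists>\<eta>\<in>policies M. Jcost phi M \<pi>0 \<eta> T = dpV phi M T T \<pi>0"
proof -
  have "\<forall>n \<pi>. \<exists>Q. good_belief \<pi> \<longrightarrow> Q \<in> Qc M \<and> dpV phi M T (Suc n) \<pi> = stage_val phi M T (dpV phi M T n) \<pi> Q"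
    using good_belief_minimizer[OF T M] by blast
  then obtain opt where opt: "\<And>n \<pi>. good_belief \<pi> \<Longrightarrow> opt n \<pi> \<in> Qc M"
    "\<And>n \<pi>. good_belief \<pi> \<Longrightarrow> dpV phi M T (Suc n) \<pi> = stage_val phi M T (dpV phi M T n) \<pi> (opt n \<pi>)"
    by metis
  \<comment> \<open>At time t, n = \<open>T - Suc t\<close> stages follow the present one, so
    \<open>opt n\<close> is the minimizer that attains \<open>dpV\<close> with \<open>Suc n\<close>
    stages left.\<close>
  define R where "R t = reachable_beliefs phi M (\<lambda>t. opt (T - Suc t)) \<pi>0 t" for t
  have "\<exists>e. (\<forall>\<pi>. e \<pi> \<in> Qc M) \<and> (\<forall>\<pi>\<in>R t \<inter> {\<pi>. good_belief \<pi>}. e \<pi> = opt (T - Suc t) \<pi>) \<and>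
    (\<lambda>(\<pi>, x). e \<pi> x) \<in> prob_algebra borel \<Otimes>\<^sub>M borel \<rightarrow>\<^sub>M count_space UNIV" for t
    using good_belief_prob opt(1) M
    by (intro ex_measurable_quantizer_selection) (auto simp: R_def finite_reachable_beliefs space_prob_algebra)
  then obtain \<eta> where \<eta>: "\<And>t \<pi>. \<eta> t \<pi> \<in> Qc M"
    "\<And>t \<pi>. \<pi> \<in> R t \<Longrightarrow> good_belief \<pi> \<Longrightarrow> \<eta> t \<pi> = opt (T - Suc t) \<pi>"
    "\<And>t. (\<lambda>(\<pi>, x). \<eta> t \<pi> x) \<in> prob_algebra borel \<Otimes>\<^sub>M borel \<rightarrow>\<^sub>M count_space UNIV"
    by (metis (mono_tags, lifting) IntI mem_Collect_eq)
  have "cost_to_go phi M T \<eta> n t \<pi> = dpV phi M T n \<pi>"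
    if "n + t = T" "\<pi> \<in> R t" "good_belief \<pi>" for n t \<pi>
    using that
  proof (induction n arbitrary: t \<pi>)
    case (Suc n)
    then have n: "T - Suc t = n" by simp
    have Q: "\<eta> t \<pi> = opt n \<pi>" using \<eta>(2)[of \<pi> t] Suc.prems n by simp
    have "stage_val phi M T (cost_to_go phi M T \<eta> n (Suc t)) \<pi> (opt n \<pi>)
        = stage_val phi M T (dpV phi M T n) \<pi> (opt n \<pi>)"
    proof (rule stage_val_cong, rule Suc.IH)
      fix m assume "m \<in> {1..M}" "emeasure \<pi> (opt n \<pi> -` {m}) \<noteq> 0"
      then show "good_belief (belief_update phi m \<pi> (opt n \<pi>))"
        using good_belief_prob[OF Suc.prems(3)] opt(1)[OF Suc.prems(3)] good_belief_update by blast
      show "belief_update phi m \<pi> (opt n \<pi>) \<in> R (Suc t)"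
        using \<open>m \<in> {1..M}\<close> Suc.prems(2) n by (force simp: R_def)
    qed (use Suc.prems in simp)
    then show ?case using opt(2)[OF Suc.prems(3), of n] Q by simp
  qed simp
  then have "Jcost phi M \<pi>0 \<eta> T = dpV phi M T T \<pi>0"
    using \<pi>0 by (simp add: Jcost_def R_def)
  moreover have "\<eta> \<in> policies M" using \<eta> by (simp add: policies_def)
  ultimately show ?thesis by blast
qed

end

section \<open>Joint measurability of the transition density\<close>

text \<open>Since \<open>phi\<close> is Lipschitz in \<open>z\<close>, it is the limit of the averages
  \<open>P(f x w \<in> ball z r) / vol (ball z r)\<close>, which are jointly measurable.\<close>

lemma lipschitz_density_jointly_measurable:
  fixes f :: "'a::euclidean_space \<Rightarrow> 'a \<Rightarrow> 'a" and phi :: "'a \<Rightarrow> 'a \<Rightarrow> real"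
  assumes f: "(\<lambda>(x, w). f x w) \<in> borel_measurable borel"
    and nu: "prob_space nu" "sets nu = sets borel"
    and dens: "\<And>x. distr nu lborel (f x) = density lborel (\<lambda>z. ennreal (phi z x))"
    and pos: "\<And>z x. 0 \<le> phi z x"
    and lip: "\<And>x. lipschitz_on C1 UNIV (\<lambda>z. phi z x)"
  shows "(\<lambda>(z, x). phi z x) \<in> borel_measurable (borel \<Otimes>\<^sub>M borel)"
proof -
  interpret prob_space nu by fact
  note [measurable_cong] = nu(2)
  have f' [measurable]: "(\<lambda>(x, w). f x w) \<in> borel_measurable (borel \<Otimes>\<^sub>M borel)"
    using f by (simp add: borel_prod)
  have [measurable]: "(\<lambda>z. phi z x) \<in> borel_measurable borel" for x
    using lipschitz_on_continuous_on[OF lip] by (rule borel_measurable_continuous_onI)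
  have C1: "0 \<le> C1" using lip by (rule lipschitz_on_nonneg)
  define r where "r n = 1 / real (Suc n)" for n
  have r: "0 < r n" for n by (simp add: r_def)
  define m where "m n z x = measure nu {w \<in> space nu. f x w \<in> ball z (r n)}" for n z x
  \<comment> \<open>On a ball of radius \<open>r n\<close> the density differs from its value at the
    centre by at most \<open>C1 * r n\<close>, and so does its average.\<close>
  have close: "\<bar>m n z x / measure lborel (ball z (r n)) - phi z x\<bar> \<le> C1 * r n" for n z x
  proof -
    have [measurable]: "ball z (r n) \<in> sets borel" by simp
    define v where "v = measure lborel (ball z (r n))"
    have v: "0 < v" "emeasure lborel (ball z (r n)) = ennreal v"
      using r[of n] content_ball_pos emeasure_lborel_ball_finite[of z "r n"]
      by (auto simp: v_def emeasure_eq_ennreal_measure top.not_eq_extremum)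
    have near: "\<bar>phi z' x - phi z x\<bar> \<le> C1 * r n" if "z' \<in> ball z (r n)" for z'
    proof -
      have "\<bar>phi z' x - phi z x\<bar> \<le> C1 * dist z' z"
        using lipschitz_onD[OF lip, of z' z] by (simp add: dist_real_def)
      also have "\<dots> \<le> C1 * r n"
        using that C1 by (intro mult_left_mono) (auto simp: dist_commute)
      finally show ?thesis .
    qed
    have near': "phi z' x \<le> phi z x + C1 * r n" "phi z x \<le> phi z' x + C1 * r n" if "z' \<in> ball z (r n)" for z'
      using near[OF that] by linarith+
    have "emeasure nu {w \<in> space nu. f x w \<in> ball z (r n)} = emeasure (distr nu lborel (f x)) (ball z (r n))"
      by (subst emeasure_distr) (auto intro!: arg_cong[of _ _ "emeasure nu"])
    also have "\<dots> = (\<integral>\<^sup>+ z'. ennreal (phi z' x) * indicator (ball z (r n)) z' \<partial>lborel)"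
      unfolding dens by (subst emeasure_density) auto
    finally have em: "ennreal (m n z x) = (\<integral>\<^sup>+ z'. ennreal (phi z' x) * indicator (ball z (r n)) z' \<partial>lborel)"
      by (simp add: m_def emeasure_eq_measure)
    have "ennreal (m n z x) \<le> (\<integral>\<^sup>+ z'. ennreal (phi z x + C1 * r n) * indicator (ball z (r n)) z' \<partial>lborel)"
      unfolding em using near' by (intro nn_integral_mono) (auto intro!: ennreal_leI simp: indicator_def)
    also have "\<dots> = ennreal ((phi z x + C1 * r n) * v)"
      using v pos[of z x] C1 r[of n] by (simp add: nn_integral_cmult_indicator ennreal_mult)
    finally have up: "m n z x \<le> (phi z x + C1 * r n) * v"
      using v pos[of z x] C1 r[of n] by (subst (asm) ennreal_le_iff) auto
    \<comment> \<open>The error term is kept on the larger side because subtraction is truncated in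
      \<open>ennreal\<close>.\<close>
    have "ennreal (phi z x * v) = (\<integral>\<^sup>+ z'. ennreal (phi z x) * indicator (ball z (r n)) z' \<partial>lborel)"
      using v pos[of z x] by (simp add: nn_integral_cmult_indicator ennreal_mult)
    also have "\<dots> \<le> (\<integral>\<^sup>+ z'. ennreal (phi z' x) * indicator (ball z (r n)) z' +
        ennreal (C1 * r n) * indicator (ball z (r n)) z' \<partial>lborel)"
      using near' pos C1 less_imp_le[OF r]
      by (intro nn_integral_mono)
        (auto intro!: ennreal_leI simp: indicator_def ennreal_plus[symmetric] simp del: ennreal_plus)
    also have "\<dots> = (\<integral>\<^sup>+ z'. ennreal (phi z' x) * indicator (ball z (r n)) z' \<partial>lborel) +
        (\<integral>\<^sup>+ z'. ennreal (C1 * r n) * indicator (ball z (r n)) z' \<partial>lborel)"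
      by (rule nn_integral_add) measurable
    also have "\<dots> = ennreal (m n z x) + ennreal (C1 * r n * v)"
      using v C1 r[of n]
      by (simp add: em[symmetric] nn_integral_cmult_indicator ennreal_mult del: ennreal_mult')
    also have "\<dots> = ennreal (m n z x + C1 * r n * v)"
      using v C1 r[of n] by (intro ennreal_plus[symmetric]) (auto simp: m_def)
    finally have "phi z x * v \<le> m n z x + C1 * r n * v"
      using v C1 r[of n] by (subst (asm) ennreal_le_iff) (auto simp: m_def)
    with up v(1) show ?thesis
      unfolding v_def[symmetric] by (simp add: abs_le_iff field_simps)
  qed
  have "(\<lambda>n. C1 * r n) \<longlonglongrightarrow> C1 * 0"
    unfolding r_def by (intro tendsto_mult tendsto_const LIMSEQ_Suc[OF lim_const_over_n])
  then have r_lim: "(\<lambda>n. C1 * r n) \<longlonglongrightarrow> 0" by simp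
  have lim: "(\<lambda>n. m n z x / measure lborel (ball z (r n))) \<longlonglongrightarrow> phi z x" for z x
    by (rule LIM_zero_cancel, rule Lim_null_comparison[OF always_eventually r_lim])
      (simp only: real_norm_def close simp_thms)
  show ?thesis
  proof (rule borel_measurable_LIMSEQ_real)
    show "(\<lambda>n. case y of (z, x) \<Rightarrow> m n z x / measure lborel (ball z (r n))) \<longlonglongrightarrow> (case y of (z, x) \<Rightarrow> phi z x)" for y
      using lim by (auto split: prod.split)
    fix n
    \<comment> \<open>\<open>m n z x\<close> is the \<open>nu\<close>-mass of the section of this
      measurable set over (z, x), hence measurable in (z, x).\<close>
    have "{y. dist (fst (fst y)) (f (snd (fst y)) (snd y)) < r n} \<in> sets ((borel \<Otimes>\<^sub>M borel) \<Otimes>\<^sub>M nu)"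
    proof -
      have "{y \<in> space ((borel \<Otimes>\<^sub>M borel) \<Otimes>\<^sub>M nu). dist (fst (fst y)) (f (snd (fst y)) (snd y)) < r n} \<in> sets ((borel \<Otimes>\<^sub>M borel) \<Otimes>\<^sub>M nu)"
        by measurable
      moreover have "space nu = UNIV" using sets_eq_imp_space_eq[OF nu(2)] by simp
      ultimately show ?thesis by (simp add: space_pair_measure)
    qed
    then have "(\<lambda>y. emeasure nu (Pair y -` {y. dist (fst (fst y)) (f (snd (fst y)) (snd y)) < r n})) \<in> borel_measurable (borel \<Otimes>\<^sub>M borel)"
      by (rule measurable_emeasure_Pair)
    then have "(\<lambda>y. enn2real (emeasure nu (Pair y -` {y. dist (fst (fst y)) (f (snd (fst y)) (snd y)) < r n}))) \<in> borel_measurable (borel \<Otimes>\<^sub>M borel)"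
      by measurable
    moreover have "space nu = UNIV" using sets_eq_imp_space_eq[OF nu(2)] by simp
    ultimately have [measurable]: "(\<lambda>(z, x). m n z x) \<in> borel_measurable (borel \<Otimes>\<^sub>M borel)"
      by (simp add: m_def measure_def case_prod_beta vimage_def)
    have "(\<lambda>(z, x). m n z x / measure lborel (ball z (r n))) = (\<lambda>y. (\<lambda>(z, x). m n z x) y / (unit_ball_vol (DIM('a)) * r n ^ DIM('a)))"
      using r[of n] by (auto simp: content_ball fun_eq_iff)
    then show "(\<lambda>(z, x). m n z x / measure lborel (ball z (r n))) \<in> borel_measurable (borel \<Otimes>\<^sub>M borel)"
      by simp
  qed
qed

section \<open>The dynamic programming equations and optimality\<close>

theorem theorem5:
  fixes f :: "'a::euclidean_space \<Rightarrow> 'a \<Rightarrow> 'a"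
    and nu_w pi0 :: "'a measure"
    and phi :: "'a \<Rightarrow> 'a \<Rightarrow> real"
    and C C1 K :: real
    and M T :: nat
  assumes f_borel: "(\<lambda>(x, w). f x w) \<in> borel_measurable borel"
    and nu_prob: "prob_space nu_w" and nu_sets: "sets nu_w = sets borel"
    and pi0_prob: "prob_space pi0" and pi0_sets: "sets pi0 = sets borel"
    and phi_density: "\<forall>x. distr nu_w lborel (f x) = density lborel (\<lambda>z. ennreal (phi z x))"
    and phi_pos_bdd: "\<forall>z x. 0 < phi z x \<and> phi z x \<le> C"
    and phi_lip: "\<forall>x. lipschitz_on C1 UNIV (\<lambda>z. phi z x)"
    and K_pos: "K > 0"
    and f_growth: "\<forall>x w. norm (f x w) \<le> K * (norm x + norm w)"
    and w_moment: "(\<integral>\<^sup>+ z. ennreal ((norm z)\<^sup>2) \<partial>nu_w) < \<infinity>"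
    and pi0_cases: "(\<exists>g\<in>borel_measurable borel. pi0 = density lborel g
                        \<and> (\<integral>\<^sup>+ x. ennreal ((norm x)\<^sup>2) \<partial>pi0) < \<infinity>)
                    \<or> (\<exists>x0. pi0 = return borel x0)"
    and M_pos: "M \<ge> 1"
    and T_pos: "T \<ge> 1"
  shows "(\<exists>\<eta>\<in>policies M. Jcost phi M pi0 \<eta> T = (INF \<eta>'\<in>policies M. Jcost phi M pi0 \<eta>' T))
       \<and> (\<forall>t\<in>{1..T-1}. \<forall>\<pi>\<in>S_class C C1. \<exists>Q\<in>Qc M.
            dpJ phi M T t \<pi> = stage_val phi M T (dpJ phi M T (Suc t)) \<pi> Q)
       \<and> (\<exists>Q\<in>Qc M. dpJ phi M T 0 pi0 = stage_val phi M T (dpJ phi M T 1) pi0 Q)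
       \<and> dpJ phi M T 0 pi0 = (INF \<eta>\<in>policies M. Jcost phi M pi0 \<eta> T)"
proof -
  have pos: "0 \<le> phi z x" for z x using phi_pos_bdd by (simp add: less_imp_le)
  have meas: "(\<lambda>(z, x). phi z x) \<in> borel_measurable (borel \<Otimes>\<^sub>M borel)"
    using phi_density phi_lip pos
    by (intro lipschitz_density_jointly_measurable[OF f_borel nu_prob nu_sets, of phi C1]) auto
  interpret transition_density phi C
  proof
    fix x
    have f_meas: "f x \<in> nu_w \<rightarrow>\<^sub>M lborel"
    proof -
      have "(\<lambda>w. (\<lambda>(x, w). f x w) (x, w)) \<in> borel_measurable borel"
        using f_borel by (rule measurable_compose[rotated]) (simp add: borel_prod[symmetric])
      then show ?thesis using nu_sets by (simp cong: measurable_cong_sets)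
    qed
    have [measurable]: "(\<lambda>z. phi z x) \<in> borel_measurable borel"
      using meas by measurable
    have "emeasure (density lborel (\<lambda>z. ennreal (phi z x))) UNIV = 1"
      using prob_space.emeasure_space_1[OF prob_space.prob_space_distr[OF nu_prob f_meas]]
      by (simp add: phi_density)
    then show "(\<integral>\<^sup>+ z. ennreal (phi z x) \<partial>lborel) = 1"
      by (simp add: emeasure_density)
  qed (use meas phi_pos_bdd pos in auto)
  have good_pi0: "good_belief pi0"
    using pi0_cases pi0_prob prob_density_iff_prob_space unfolding good_belief_def by blast
  obtain \<eta> where \<eta>: "\<eta> \<in> policies M" "Jcost phi M pi0 \<eta> T = dpV phi M T T pi0"
    using optimal_policy_exists[OF T_pos M_pos good_pi0] by blast
  \<comment> \<open>One inequality bounds every policy from below; the other comes from the policy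
    just constructed.\<close>
  have INF: "dpV phi M T T pi0 = (INF \<eta>\<in>policies M. Jcost phi M pi0 \<eta> T)"
  proof (rule antisym)
    show "dpV phi M T T pi0 \<le> (INF \<eta>\<in>policies M. Jcost phi M pi0 \<eta> T)"
      using pi0_prob pi0_sets by (auto intro!: INF_greatest dpV_le_cost_to_go simp: Jcost_def)
    show "(INF \<eta>\<in>policies M. Jcost phi M pi0 \<eta> T) \<le> dpV phi M T T pi0"
      using \<eta> by (metis INF_lower)
  qed
  have bellman: "\<exists>Q\<in>Qc M. dpJ phi M T t \<pi> = stage_val phi M T (dpJ phi M T (Suc t)) \<pi> Q"
    if "t < T" "good_belief \<pi>" for t \<pi>
  proof -
    \<comment> \<open>One more stage remains at t than at t + 1; for t \<ge> T truncated subtraction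
      would make both counts zero.\<close>
    have "T - t = Suc (T - Suc t)" using that by simp
    moreover have "dpJ phi M T (Suc t) = dpV phi M T (T - Suc t)" by (simp add: dpJ_def fun_eq_iff)
    ultimately show ?thesis
      using good_belief_minimizer[OF T_pos M_pos that(2), of "T - Suc t"] by (simp add: dpJ_def)
  qed
  have "good_belief \<pi>" if \<pi>: "\<pi> \<in> S_class C C1" for \<pi>
  proof -
    obtain g where g: "prob_space \<pi>" "\<pi> = density lborel (\<lambda>x. ennreal (g x))" "lipschitz_on C1 UNIV g"
      using \<pi> unfolding S_class_def by blast
    have "g \<in> borel_measurable borel"
      using lipschitz_on_continuous_on[OF g(3)] by (rule borel_measurable_continuous_onI)
    then have "prob_density (\<lambda>x. ennreal (g x))"
      using g by (subst prob_density_iff_prob_space) auto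
    then show ?thesis using g(2) by (auto simp: good_belief_def)
  qed
  then have "\<forall>t\<in>{1..T-1}. \<forall>\<pi>\<in>S_class C C1. \<exists>Q\<in>Qc M.
      dpJ phi M T t \<pi> = stage_val phi M T (dpJ phi M T (Suc t)) \<pi> Q"
    using bellman by auto
  moreover have "\<exists>Q\<in>Qc M. dpJ phi M T 0 pi0 = stage_val phi M T (dpJ phi M T 1) pi0 Q"
    using bellman[OF _ good_pi0, of 0] T_pos by simp
  moreover have "dpJ phi M T 0 pi0 = (INF \<eta>\<in>policies M. Jcost phi M pi0 \<eta> T)"
    using INF by (simp add: dpJ_def)
  ultimately show ?thesis using \<eta> INF by auto
qed

end
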